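(* Let $n$ be a positive integer and $p\in(0,1)$. Let $\{I_{i,j}:1\le i<j\le n\}$ be independent Bernoulli$(p)$ random variables (edge indicators of a Bernoulli random graph $G(n,p)$), and let $$\mathbf{T}_n(t)=\frac{\lfloor nt\rfloor-2}{n^2}\sum_{1\le i<j\le\lfloor nt\rfloor}I_{i,j},\qquad \mathbf{Y}_n(t)=\mathbf{T}_n(t)-\mathbb{E}\mathbf{T}_n(t),\qquad t\in[0,1].$$ Let $$\mathbf{Z}(t)=\left(\frac{p(1-p)}{2}\right)^{1/2}t\,\mathbf{B}(t^2),\qquad t\in[0,1],$$ where $\mathbf{B}$ is a standard Brownian motion. Then, for any $g\in M^2$, $$|\mathbb{E}g(\mathbf{Y}_n)-\mathbb{E}g(\mathbf{Z})|\le\|g\|_{M^2}\left(9n^{-1}+90n^{-1/2}\sqrt{\log n}\right).$$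
   Context: $D=D([0,1],\mathbb{R})$ is the Skorokhod space of càdlàg functions $[0,1]\to\mathbb{R}$, with $\|w\|=\sup_{t\in[0,1]}|w(t)|$. Fréchet derivatives are with respect to this norm, and a $k$-linear form $B$ on $D$ has norm $\|B\|=\sup_{\{h:\|h\|=1\}}|B[h,\dots,h]|$. $M$ is the set of continuous functions $f:D\to\mathbb{R}$ with $\sup_{w\in D}\frac{|f(w)|}{1+\|w\|^3}<\infty$ that are twice Fréchet differentiable and satisfy $\|D^2f(w+h)-D^2f(w)\|\le k_f\|h\|$ for some constant $k_f$, uniformly in $w,h\in D$. $M^2$ is the set of $g\in M$ with $$\|g\|_{M^2}=\sup_{w}\frac{|g(w)|}{1+\|w\|^3}+\sup_{w}\frac{\|Dg(w)\|}{1+\|w\|}+\sup_{w}\frac{\|D^2g(w)\|}{1+\|w\|}+\sup_{w,h}\frac{\|D^2g(w+h)-D^2g(w)\|}{\|h\|}<\infty .$$ *)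

theory Defs
  imports "HOL-Probability.Probability"
begin

section \<open>The space \<open>D([0,1], \<real>)\<close> with the supremum norm\<close>

definition cadlag :: "(real \<Rightarrow> real) \<Rightarrow> bool" where
  "cadlag w \<longleftrightarrow>
     (\<forall>t\<in>{0..<1}. (w \<longlongrightarrow> w t) (at_right t)) \<and>
     (\<forall>t\<in>{0<..1}. \<exists>l. (w \<longlongrightarrow> l) (at_left t))"

lemma cadlag_locally_bounded:
  assumes w: "cadlag w" and t: "t \<in> {0..1}"
  shows "\<exists>C. \<forall>\<^sub>F s in nhds t. s \<in> {0..1} \<longrightarrow> \<bar>w s\<bar> \<le> C"
proof -
  have bd: "\<exists>C. \<forall>\<^sub>F s in F. \<bar>w s\<bar> \<le> C" if "(w \<longlongrightarrow> l) F" for l F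
  proof -
    have "((\<lambda>s. \<bar>w s\<bar>) \<longlongrightarrow> \<bar>l\<bar>) F" using that by (rule tendsto_rabs)
    then have "\<forall>\<^sub>F s in F. \<bar>w s\<bar> < \<bar>l\<bar> + 1" by (rule order_tendstoD) simp
    then have "\<forall>\<^sub>F s in F. \<bar>w s\<bar> \<le> \<bar>l\<bar> + 1" by eventually_elim simp
    then show ?thesis by blast
  qed
  have "\<exists>C. \<forall>\<^sub>F s in at_right t. s \<in> {0..1} \<longrightarrow> \<bar>w s\<bar> \<le> C"
  proof (cases "t < 1")
    case True
    with t w have "(w \<longlongrightarrow> w t) (at_right t)" by (simp add: cadlag_def)
    then obtain C where "\<forall>\<^sub>F s in at_right t. \<bar>w s\<bar> \<le> C" using bd by blast
    then have "\<forall>\<^sub>F s in at_right t. s \<in> {0..1} \<longrightarrow> \<bar>w s\<bar> \<le> C" by eventually_elim simp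
    then show ?thesis by blast
  next
    case False
    with t have "t = 1" by simp
    moreover have "\<forall>\<^sub>F s in at_right (1::real). s \<in> {0..1} \<longrightarrow> \<bar>w s\<bar> \<le> 0"
      using eventually_at_right_less[of "1::real"] by eventually_elim simp
    ultimately show ?thesis by blast
  qed
  then obtain C1 where C1: "\<forall>\<^sub>F s in at_right t. s \<in> {0..1} \<longrightarrow> \<bar>w s\<bar> \<le> C1" by blast
  have "\<exists>C. \<forall>\<^sub>F s in at_left t. s \<in> {0..1} \<longrightarrow> \<bar>w s\<bar> \<le> C"
  proof (cases "0 < t")
    case True
    with t w obtain l where "(w \<longlongrightarrow> l) (at_left t)" unfolding cadlag_def by fastforce
    then obtain C where "\<forall>\<^sub>F s in at_left t. \<bar>w s\<bar> \<le> C" using bd by blast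
    then have "\<forall>\<^sub>F s in at_left t. s \<in> {0..1} \<longrightarrow> \<bar>w s\<bar> \<le> C" by eventually_elim simp
    then show ?thesis by blast
  next
    case False
    with t have "t = 0" by simp
    moreover have "\<forall>\<^sub>F s in at_left (0::real). s < 0"
      by (rule eventually_at_leftI[of "-1"]) auto
    then have "\<forall>\<^sub>F s in at_left (0::real). s \<in> {0..1} \<longrightarrow> \<bar>w s\<bar> \<le> 0"
      by eventually_elim simp
    ultimately show ?thesis by blast
  qed
  then obtain C2 where C2: "\<forall>\<^sub>F s in at_left t. s \<in> {0..1} \<longrightarrow> \<bar>w s\<bar> \<le> C2" by blast
  let ?C = "max \<bar>w t\<bar> (max C1 C2)"
  have "\<forall>\<^sub>F s in at_right t. s \<in> {0..1} \<longrightarrow> \<bar>w s\<bar> \<le> ?C"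
    using C1 by eventually_elim auto
  moreover have "\<forall>\<^sub>F s in at_left t. s \<in> {0..1} \<longrightarrow> \<bar>w s\<bar> \<le> ?C"
    using C2 by eventually_elim auto
  ultimately have "\<forall>\<^sub>F s in at t. s \<in> {0..1} \<longrightarrow> \<bar>w s\<bar> \<le> ?C"
    by (simp add: eventually_at_split)
  then have "\<forall>\<^sub>F s in nhds t. s \<noteq> t \<longrightarrow> s \<in> {0..1} \<longrightarrow> \<bar>w s\<bar> \<le> ?C"
    by (simp add: eventually_at_filter)
  then have "\<forall>\<^sub>F s in nhds t. s \<in> {0..1} \<longrightarrow> \<bar>w s\<bar> \<le> ?C"
    by eventually_elim (metis max.cobounded1)
  then show ?thesis by blast
qed

lemma cadlag_bounded:
  assumes w: "cadlag w"
  shows "\<exists>C. \<forall>t\<in>{0..1}. \<bar>w t\<bar> \<le> C"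
proof -
  have "\<forall>t\<in>{0..1}. \<exists>U C. open U \<and> t \<in> U \<and> (\<forall>s\<in>U. s \<in> {0..1} \<longrightarrow> \<bar>w s\<bar> \<le> C)"
    using cadlag_locally_bounded[OF w] unfolding eventually_nhds by meson
  then obtain U C where UC: "\<And>t. t \<in> {0..1} \<Longrightarrow> open (U t) \<and> t \<in> U t"
    "\<And>t s. t \<in> {0..1} \<Longrightarrow> s \<in> U t \<Longrightarrow> s \<in> {0..1} \<Longrightarrow> \<bar>w s\<bar> \<le> (C t :: real)"
    by metis
  have cov: "{0..1::real} \<subseteq> (\<Union>t\<in>{0..1}. U t)" using UC(1) by blast
  obtain T where T: "T \<subseteq> {0..1}" "finite T" "{0..1::real} \<subseteq> (\<Union>t\<in>T. U t)"
    by (rule compactE_image[OF compact_Icc _ cov]) (use UC(1) in auto)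
  have "\<bar>w s\<bar> \<le> (\<Sum>t\<in>T. \<bar>C t\<bar>)" if s: "s \<in> {0..1}" for s
  proof -
    obtain t where t: "t \<in> T" "s \<in> U t" using T(3) s by blast
    have "\<bar>w s\<bar> \<le> \<bar>C t\<bar>" using UC(2)[of t s] T(1) t s by auto
    also have "\<dots> \<le> (\<Sum>t\<in>T. \<bar>C t\<bar>)"
      using T(2) t(1) by (intro member_le_sum) auto
    finally show ?thesis .
  qed
  then show ?thesis by blast
qed

lemma cadlag_lin:
  assumes v: "cadlag v" and w: "cadlag w"
  shows "cadlag (\<lambda>t. a * v t + b * w t)"
  unfolding cadlag_def
proof (intro conjI ballI)
  fix t :: real assume t: "t \<in> {0..<1}"
  then have "(v \<longlongrightarrow> v t) (at_right t)" "(w \<longlongrightarrow> w t) (at_right t)"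
    using v w by (auto simp: cadlag_def)
  then show "((\<lambda>t. a * v t + b * w t) \<longlongrightarrow> a * v t + b * w t) (at_right t)"
    by (intro tendsto_intros)
next
  fix t :: real assume t: "t \<in> {0<..1}"
  then obtain k l where "(v \<longlongrightarrow> k) (at_left t)" "(w \<longlongrightarrow> l) (at_left t)"
    using v w unfolding cadlag_def by blast
  then have "((\<lambda>t. a * v t + b * w t) \<longlongrightarrow> a * k + b * l) (at_left t)"
    by (intro tendsto_intros)
  then show "\<exists>l. ((\<lambda>t. a * v t + b * w t) \<longlongrightarrow> l) (at_left t)" by blast
qed

text \<open>Elements are extended by \<open>0\<close> outside \<open>[0,1]\<close>, so that equality in the type is
  equality on \<open>[0,1]\<close>.\<close>

typedef skorokhod = "{w. cadlag w \<and> (\<forall>t. t \<notin> {0..1} \<longrightarrow> w t = 0)}"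
  morphisms sk_path Abs_skorokhod
  by (rule exI[of _ "\<lambda>_. 0"]) (auto simp: cadlag_def)

setup_lifting type_definition_skorokhod

lemma cadlag_path: "cadlag (sk_path w)" and path_outside: "t \<notin> {0..1} \<Longrightarrow> sk_path w t = 0"
  using sk_path[of w] by auto

lemma path_eqI:
  assumes "\<And>t. t \<in> {0..1} \<Longrightarrow> sk_path v t = sk_path w t"
  shows "v = w"
  by (metis assms ext sk_path_inject path_outside)

lemma bdd_above_path: "bdd_above ((\<lambda>t. \<bar>sk_path w t\<bar>) ` {0..1})"
  using cadlag_bounded[OF cadlag_path[of w]] by (auto simp: bdd_above_def)

instantiation skorokhod :: real_normed_vector
begin

lift_definition zero_skorokhod :: skorokhod is "\<lambda>_. 0"
  by (auto simp: cadlag_def)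

lift_definition plus_skorokhod :: "skorokhod \<Rightarrow> skorokhod \<Rightarrow> skorokhod" is "\<lambda>v w t. v t + w t"
  by (simp add: cadlag_lin[where a = 1 and b = 1, simplified])

lift_definition uminus_skorokhod :: "skorokhod \<Rightarrow> skorokhod" is "\<lambda>w t. - w t"
  using cadlag_lin[where a = "-1" and b = 0] by (simp, blast)

lift_definition minus_skorokhod :: "skorokhod \<Rightarrow> skorokhod \<Rightarrow> skorokhod" is "\<lambda>v w t. v t - w t"
  using cadlag_lin[where a = 1 and b = "-1"] by simp

lift_definition scaleR_skorokhod :: "real \<Rightarrow> skorokhod \<Rightarrow> skorokhod" is "\<lambda>c w t. c * w t"
  using cadlag_lin[where b = 0] by (simp, blast)

definition norm_skorokhod :: "skorokhod \<Rightarrow> real" where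
  "norm_skorokhod w = (SUP t\<in>{0..1}. \<bar>sk_path w t\<bar>)"

definition sgn_skorokhod :: "skorokhod \<Rightarrow> skorokhod" where
  "sgn_skorokhod w = inverse (norm w) *\<^sub>R w"

definition dist_skorokhod :: "skorokhod \<Rightarrow> skorokhod \<Rightarrow> real" where
  "dist_skorokhod v w = norm (v - w)"

definition uniformity_skorokhod :: "(skorokhod \<times> skorokhod) filter" where
  "uniformity_skorokhod = (INF e\<in>{0<..}. principal {(v, w). dist v w < e})"

definition open_skorokhod :: "skorokhod set \<Rightarrow> bool" where
  "open_skorokhod U \<longleftrightarrow> (\<forall>v\<in>U. \<forall>\<^sub>F (v', w) in uniformity. v' = v \<longrightarrow> w \<in> U)"

instance
proof
  fix u v w :: skorokhod and a b :: real
  show "u + v + w = u + (v + w)" by transfer (simp add: algebra_simps)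
  show "u + v = v + u" by transfer (simp add: algebra_simps)
  show "0 + u = u" by transfer simp
  show "- u + u = 0" by transfer simp
  show "u - v = u + - v" by transfer simp
  show "a *\<^sub>R (u + v) = a *\<^sub>R u + a *\<^sub>R v" by transfer (simp add: algebra_simps)
  show "(a + b) *\<^sub>R u = a *\<^sub>R u + b *\<^sub>R u" by transfer (simp add: algebra_simps)
  show "a *\<^sub>R b *\<^sub>R u = (a * b) *\<^sub>R u" by transfer (simp add: algebra_simps)
  show "1 *\<^sub>R u = u" by transfer simp
  show "sgn u = inverse (norm u) *\<^sub>R u" by (rule sgn_skorokhod_def)
  show "dist u v = norm (u - v)" by (rule dist_skorokhod_def)
  show "uniformity = (INF e\<in>{0<..}. principal {(v::skorokhod, w). dist v w < e})"
    by (rule uniformity_skorokhod_def)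
  show "open U \<longleftrightarrow> (\<forall>v\<in>U. \<forall>\<^sub>F (v', w) in uniformity. v' = v \<longrightarrow> w \<in> U)"
    for U :: "skorokhod set" by (rule open_skorokhod_def)
  have le: "\<bar>sk_path x t\<bar> \<le> norm x" if "t \<in> {0..1}" for x t
    unfolding norm_skorokhod_def using that bdd_above_path by (rule cSUP_upper)
  have ge0: "0 \<le> norm x" for x :: skorokhod
    using le[of 0 x] by simp
  show "norm u = 0 \<longleftrightarrow> u = 0"
  proof
    assume "norm u = 0"
    then show "u = 0" using le[of _ u]
      by (intro path_eqI) (fastforce simp: zero_skorokhod.rep_eq)
  qed (simp add: norm_skorokhod_def zero_skorokhod.rep_eq)
  have tri: "\<bar>sk_path u t + sk_path v t\<bar> \<le> norm u + norm v" if "t \<in> {0..1}" for t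
    using le[OF that, of u] le[OF that, of v] by linarith
  show "norm (u + v) \<le> norm u + norm v"
    unfolding norm_skorokhod_def[of "u + v"] plus_skorokhod.rep_eq
    by (rule cSUP_least) (use tri in auto)
  have sc: "norm (c *\<^sub>R x) \<le> \<bar>c\<bar> * norm x" for c and x :: skorokhod
    unfolding norm_skorokhod_def[of "c *\<^sub>R x"] scaleR_skorokhod.rep_eq
    by (rule cSUP_least) (auto simp: abs_mult intro!: mult_left_mono le)
  show "norm (a *\<^sub>R u) = \<bar>a\<bar> * norm u"
  proof (cases "a = 0")
    case True
    then show ?thesis using sc[of a u] ge0[of "a *\<^sub>R u"] by simp
  next
    case False
    have "inverse a *\<^sub>R a *\<^sub>R u = u"
      using False by transfer (simp add: fun_eq_iff)
    then have "norm u \<le> \<bar>inverse a\<bar> * norm (a *\<^sub>R u)"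
      using sc[of "inverse a" "a *\<^sub>R u"] by simp
    then have "\<bar>a\<bar> * norm u \<le> norm (a *\<^sub>R u)"
      using False by (simp add: field_simps abs_inverse)
    then show ?thesis using sc[of a u] by simp
  qed
qed

end

text \<open>The element of the Skorokhod space given by a function that is cadlag on \<open>[0,1]\<close>.\<close>

definition skor :: "(real \<Rightarrow> real) \<Rightarrow> skorokhod" where
  "skor w = Abs_skorokhod (\<lambda>t. if t \<in> {0..1} then w t else 0)"

lemma path_skor:
  assumes "cadlag w"
  shows "sk_path (skor w) = (\<lambda>t. if t \<in> {0..1} then w t else 0)"
proof -
  have "cadlag (\<lambda>t. if t \<in> {0..1} then w t else 0)"
    unfolding cadlag_def
  proof (intro conjI ballI)
    fix t :: real assume t: "t \<in> {0..<1}"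
    then have "(w \<longlongrightarrow> w t) (at_right t)" using assms by (simp add: cadlag_def)
    moreover have "\<forall>\<^sub>F s in at_right t. w s = (if s \<in> {0..1} then w s else 0)"
      by (rule eventually_at_rightI[of _ 1]) (use t in auto)
    ultimately show "((\<lambda>t. if t \<in> {0..1} then w t else 0) \<longlongrightarrow>
        (if t \<in> {0..1} then w t else 0)) (at_right t)"
      using t by (auto intro: Lim_transform_eventually)
  next
    fix t :: real assume t: "t \<in> {0<..1}"
    then obtain l where "(w \<longlongrightarrow> l) (at_left t)" using assms unfolding cadlag_def by blast
    moreover have "\<forall>\<^sub>F s in at_left t. w s = (if s \<in> {0..1} then w s else 0)"
      by (rule eventually_at_leftI[of 0]) (use t in auto)
    ultimately show "\<exists>l. ((\<lambda>t. if t \<in> {0..1} then w t else 0) \<longlongrightarrow> l) (at_left t)"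
      by (blast intro: Lim_transform_eventually)
  qed
  then show ?thesis unfolding skor_def by (intro Abs_skorokhod_inverse) auto
qed

lemma cadlag_continuous:
  assumes "continuous_on {0..1} w"
  shows "cadlag w"
  unfolding cadlag_def
proof (intro conjI ballI)
  fix t :: real assume t: "t \<in> {0..<1}"
  then have "(w \<longlongrightarrow> w t) (at t within {0..1})" using assms by (simp add: continuous_on_def)
  then have "(w \<longlongrightarrow> w t) (at t within {t..1})"
    by (rule tendsto_within_subset) (use t in auto)
  then show "(w \<longlongrightarrow> w t) (at_right t)" using t at_within_Icc_at_right[of t 1] by simp
next
  fix t :: real assume t: "t \<in> {0<..1}"
  then have "(w \<longlongrightarrow> w t) (at t within {0..1})" using assms by (simp add: continuous_on_def)
  then have "(w \<longlongrightarrow> w t) (at t within {0..t})"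
    by (rule tendsto_within_subset) (use t in auto)
  then show "\<exists>l. (w \<longlongrightarrow> l) (at_left t)" using t at_within_Icc_at_left[of 0 t] by auto
qed

lemma cadlag_floor:
  assumes c: "c > 0"
  shows "cadlag (\<lambda>t. F \<lfloor>c * t\<rfloor>)"
  unfolding cadlag_def
proof (intro conjI ballI)
  fix t :: real
  have "\<forall>\<^sub>F s in at_right t. F \<lfloor>c * t\<rfloor> = F \<lfloor>c * s\<rfloor>"
  proof (rule eventually_at_rightI[of _ "(real_of_int \<lfloor>c * t\<rfloor> + 1) / c"])
    fix s assume s: "s \<in> {t<..<(real_of_int \<lfloor>c * t\<rfloor> + 1) / c}"
    then have "c * t < c * s" "c * s < real_of_int \<lfloor>c * t\<rfloor> + 1"
      using c by (auto simp: field_simps)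
    then have "\<lfloor>c * s\<rfloor> = \<lfloor>c * t\<rfloor>" by linarith
    then show "F \<lfloor>c * t\<rfloor> = F \<lfloor>c * s\<rfloor>" by simp
  qed (use c in \<open>simp add: field_simps; linarith\<close>)
  then show "((\<lambda>t. F \<lfloor>c * t\<rfloor>) \<longlongrightarrow> F \<lfloor>c * t\<rfloor>) (at_right t)"
    by (rule Lim_transform_eventually[OF tendsto_const])
next
  fix t :: real
  have "\<forall>\<^sub>F s in at_left t. F (\<lceil>c * t\<rceil> - 1) = F \<lfloor>c * s\<rfloor>"
  proof (rule eventually_at_leftI[of "(real_of_int \<lceil>c * t\<rceil> - 1) / c"])
    fix s assume s: "s \<in> {(real_of_int \<lceil>c * t\<rceil> - 1) / c<..<t}"
    then have "c * s < c * t" "real_of_int \<lceil>c * t\<rceil> - 1 < c * s"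
      using c by (auto simp: field_simps)
    then have "\<lfloor>c * s\<rfloor> = \<lceil>c * t\<rceil> - 1" by linarith
    then show "F (\<lceil>c * t\<rceil> - 1) = F \<lfloor>c * s\<rfloor>" by simp
  qed (use c in \<open>simp add: field_simps; linarith\<close>)
  then show "\<exists>l. ((\<lambda>t. F \<lfloor>c * t\<rfloor>) \<longlongrightarrow> l) (at_left t)"
    by (blast intro: Lim_transform_eventually[OF tendsto_const])
qed

section \<open>Frechet derivatives and the classes \<open>M\<close> and \<open>M\<^sup>2\<close>\<close>

text \<open>The library's \<^const>\<open>frechet_derivative\<close>, packaged as a bounded linear map so that it can be
  differentiated again; meaningful where the function is differentiable.\<close>

definition frechet ::
    "('a::real_normed_vector \<Rightarrow> 'b::real_normed_vector) \<Rightarrow> 'a \<Rightarrow> 'a \<Rightarrow>\<^sub>L 'b" where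
  "frechet f w = Blinfun (frechet_derivative f (at w))"

lemma has_derivative_frechet:
  assumes "f differentiable (at w)"
  shows "(f has_derivative blinfun_apply (frechet f w)) (at w)"
  using assms unfolding frechet_def frechet_derivative_works
  by (simp add: bounded_linear_Blinfun_apply has_derivative_bounded_linear)

text \<open>The norm of a \<open>k\<close>-linear form \<open>B\<close>, as a function of its diagonal
  \<open>h \<mapsto> B[h, \<dots>, h]\<close>. For \<open>k = 2\<close> this is not the operator norm of
  \<open>D \<Rightarrow>\<^sub>L D \<Rightarrow>\<^sub>L \<real>\<close>.\<close>

definition form_norm :: "(skorokhod \<Rightarrow> real) \<Rightarrow> real" where
  "form_norm B = (SUP h\<in>{h. norm h = 1}. \<bar>B h\<bar>)"

lemma bdd_above_linear_form:
  "bdd_above ((\<lambda>h. \<bar>blinfun_apply L h\<bar>) ` {h. norm h = 1})"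
  for L :: "skorokhod \<Rightarrow>\<^sub>L real"
proof (rule bdd_aboveI2[of _ _ "norm L"])
  fix h :: skorokhod assume "h \<in> {h. norm h = 1}"
  then show "\<bar>L h\<bar> \<le> norm L" using norm_blinfun[of L h] by simp
qed

lemma bdd_above_bilinear_form:
  fixes B :: "skorokhod \<Rightarrow>\<^sub>L skorokhod \<Rightarrow>\<^sub>L real"
  shows "bdd_above ((\<lambda>h. \<bar>blinfun_apply (blinfun_apply B h) h\<bar>) ` {h. norm h = 1})"
proof (rule bdd_aboveI2[of _ _ "norm B"])
  fix h :: skorokhod assume h: "h \<in> {h. norm h = 1}"
  have "norm (B h h) \<le> norm (B h) * norm h" by (rule norm_blinfun)
  also have "\<dots> \<le> norm B * norm h * norm h" by (intro mult_right_mono norm_blinfun) simp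
  finally show "\<bar>B h h\<bar> \<le> norm B" using h by simp
qed

abbreviation D2 :: "(skorokhod \<Rightarrow> real) \<Rightarrow> skorokhod \<Rightarrow> skorokhod \<Rightarrow>\<^sub>L skorokhod \<Rightarrow>\<^sub>L real" where
  "D2 f \<equiv> frechet (frechet f)"

definition M_class :: "(skorokhod \<Rightarrow> real) set" where
  "M_class = {f.
     continuous_on UNIV f \<and>
     (SUP w. ennreal (\<bar>f w\<bar> / (1 + norm w ^ 3))) < \<infinity> \<and>
     (\<forall>w. f differentiable (at w)) \<and>
     (\<forall>w. frechet f differentiable (at w)) \<and>
     (\<exists>k. \<forall>w h. form_norm (\<lambda>u. (D2 f (w + h) - D2 f w) u u) \<le> k * norm h)}"

definition M2_norm :: "(skorokhod \<Rightarrow> real) \<Rightarrow> ennreal" where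
  "M2_norm g =
     (SUP w. ennreal (\<bar>g w\<bar> / (1 + norm w ^ 3))) +
     (SUP w. ennreal (form_norm (\<lambda>u. frechet g w u) / (1 + norm w))) +
     (SUP w. ennreal (form_norm (\<lambda>u. D2 g w u u) / (1 + norm w))) +
     (SUP w. SUP h\<in>{h. h \<noteq> 0}.
        ennreal (form_norm (\<lambda>u. (D2 g (w + h) - D2 g w) u u) / norm h))"

definition M2_class :: "(skorokhod \<Rightarrow> real) set" where
  "M2_class = {g \<in> M_class. M2_norm g < \<infinity>}"

section \<open>The processes\<close>

definition edges :: "nat \<Rightarrow> (nat \<times> nat) set" where
  "edges m = {(i, j). 1 \<le> i \<and> i < j \<and> j \<le> m}"

definition T_proc :: "nat \<Rightarrow> (nat \<times> nat \<Rightarrow> 'a \<Rightarrow> real) \<Rightarrow> 'a \<Rightarrow> real \<Rightarrow> real" where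
  "T_proc n I \<omega> t =
     (real_of_int \<lfloor>real n * t\<rfloor> - 2) / (real n)\<^sup>2 *
       (\<Sum>e\<in>edges (nat \<lfloor>real n * t\<rfloor>). I e \<omega>)"

definition Y_proc :: "'a measure \<Rightarrow> nat \<Rightarrow> (nat \<times> nat \<Rightarrow> 'a \<Rightarrow> real) \<Rightarrow> 'a \<Rightarrow> real \<Rightarrow> real" where
  "Y_proc P n I \<omega> t = T_proc n I \<omega> t - (\<integral>\<omega>'. T_proc n I \<omega>' t \<partial>P)"

definition Z_proc :: "real \<Rightarrow> (real \<Rightarrow> 'b \<Rightarrow> real) \<Rightarrow> 'b \<Rightarrow> real \<Rightarrow> real" where
  "Z_proc p B \<omega> t = sqrt (p * (1 - p) / 2) * t * B (t\<^sup>2) \<omega>"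

definition bernoulli_rv :: "'a measure \<Rightarrow> real \<Rightarrow> ('a \<Rightarrow> real) \<Rightarrow> bool" where
  "bernoulli_rv P p X \<longleftrightarrow>
     X \<in> borel_measurable P \<and>
     distr P borel X = distr (measure_pmf (bernoulli_pmf p)) borel of_bool"

text \<open>The second argument of \<^const>\<open>normal_density\<close> below is the standard deviation. Every path is
  required to be continuous, so that \<open>Z_proc\<close> has paths in the Skorokhod space.\<close>

locale standard_brownian_motion = prob_space Q for Q :: "'b measure" +
  fixes B :: "real \<Rightarrow> 'b \<Rightarrow> real"
  assumes measurable_BM: "\<And>t. 0 \<le> t \<Longrightarrow> B t \<in> borel_measurable Q"
    and BM_zero: "AE \<omega> in Q. B 0 \<omega> = 0"
    and BM_independent_increments:
      "\<And>t (m::nat). 0 \<le> t 0 \<Longrightarrow> (\<And>i. i < m \<Longrightarrow> t i \<le> t (Suc i)) \<Longrightarrow>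
         indep_vars (\<lambda>_. borel) (\<lambda>i \<omega>. B (t (Suc i)) \<omega> - B (t i) \<omega>) {..<m}"
    and BM_normal_increments:
      "\<And>s t. 0 \<le> s \<Longrightarrow> s < t \<Longrightarrow>
         distributed Q lborel (\<lambda>\<omega>. B t \<omega> - B s \<omega>) (normal_density 0 (sqrt (t - s)))"
    and BM_continuous: "\<And>\<omega>. \<omega> \<in> space Q \<Longrightarrow> continuous_on {0..} (\<lambda>t. B t \<omega>)"

lemma cadlag_Y_proc:
  assumes "n > 0"
  shows "cadlag (Y_proc P n I \<omega>)"
proof -
  let ?F = "\<lambda>k \<omega>. (real_of_int k - 2) / (real n)\<^sup>2 * (\<Sum>e\<in>edges (nat k). I e \<omega>)"
  have "cadlag (\<lambda>t. (\<lambda>k. ?F k \<omega> - (\<integral>\<omega>'. ?F k \<omega>' \<partial>P)) \<lfloor>real n * t\<rfloor>)"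
    using assms by (intro cadlag_floor) simp
  then show ?thesis by (simp add: Y_proc_def[abs_def] T_proc_def)
qed

lemma (in standard_brownian_motion) cadlag_Z_proc:
  assumes "\<omega> \<in> space Q"
  shows "cadlag (Z_proc p B \<omega>)"
  unfolding Z_proc_def
  by (intro cadlag_continuous continuous_intros continuous_on_compose2[OF BM_continuous[OF assms]]) auto

end

theory Submission
  imports Defs
begin

text \<open>The centred process is \<open>\<Sum>\<^sub>e (I\<^sub>e - p) h\<^sub>e\<close>, where \<open>e\<close> ranges over the possible edges and the
  fixed paths \<open>h\<^sub>e\<close> have norm at most \<open>1/n\<close>. As \<open>D\<^sup>2g\<close> is Lipschitz, Lindeberg's replacement
  argument exchanges the \<open>I\<^sub>e - p\<close> for centred Gaussian variables of the same variance at a total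
  cost of order \<open>n\<^sup>2 (1/n)\<^sup>3 = 1/n\<close>. These Gaussian variables can be taken to be suitably scaled
  increments of \<open>B\<close> itself over the \<open>n(n-1)/2\<close> consecutive intervals of length \<open>2/n\<^sup>2\<close>, with the
  edges ordered by their larger endpoint. The sums then telescope, and with \<open>m = \<lfloor>nt\<rfloor>\<close> the
  Gaussian process becomes
  \<open>\<surd>(p(1-p)/2) (m-2)/n B(m(m-1)/n\<^sup>2)\<close>, which lives on the same space as \<open>Z\<close> and differs from it
  only through time shifts of at most \<open>3/n\<close>. A chaining bound on the modulus of continuity of \<open>B\<close>
  makes this last difference of order \<open>\<surd>(ln n / n)\<close>.\<close>

section \<open>Lindeberg's replacement argument\<close>

text \<open>The sup norm makes \<open>skorokhod\<close> non-separable, so random paths are not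
  treated as measurable maps into it. Each functional is instead a continuous function of finitely
  many real variables, or a limit of such functions. The first derivative of a test function may
  grow linearly, so no global Lipschitz bound is available. The comparison on the space of
  \<open>B\<close> therefore meets a product of the form (1 + supremum) * (modulus of continuity).
  Weighted arithmetic-geometric mean inequalities turn it into squares, whose expectations are
  explicit. With K the norm of the test function, the exchange costs K/(2n) and the comparison costs
  K(63 sqrt(ln n / n) + 36/n). The excess 27.5/n over the allowed 9/n is absorbed by the spare 27
  sqrt(ln n / n) when n is at least 2. For n = 1 the logarithm vanishes, but there are no edges, so
  the centred process is zero and the distance from g(0) to the expectation of g(Z) is bounded
  directly by 9K.\<close>

lemma borel_measurable_linear_combination:
  fixes g :: "'v::real_normed_vector \<Rightarrow> real" and h :: "'i::countable \<Rightarrow> 'v"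
  assumes g: "continuous_on UNIV g" and X: "\<And>k. k \<in> K \<Longrightarrow> X k \<in> borel_measurable M"
  shows "(\<lambda>\<omega>. g (\<Sum>k\<in>K. X k \<omega> *\<^sub>R h k)) \<in> borel_measurable M"
proof -
  let ?G = "\<lambda>y::'i \<Rightarrow> real. g (\<Sum>k\<in>K. y k *\<^sub>R h k)"
  have "continuous_on UNIV ?G"
    by (intro continuous_on_compose2[OF g] continuous_intros) auto
  then have [measurable]: "?G \<in> borel_measurable borel"
    by (rule borel_measurable_continuous_onI)
  \<comment> \<open>Measurability into the function space is checked coordinatewise, which rests on
    the countable index type. The value 0 outside \<open>K\<close> makes every coordinate
    measurable.\<close>
  have [measurable]: "(\<lambda>\<omega> k. if k \<in> K then X k \<omega> else 0) \<in> borel_measurable M"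
  proof (rule measurable_coordinatewise_then_product)
    show "(\<lambda>\<omega>. if k \<in> K then X k \<omega> else 0) \<in> borel_measurable M" for k
      using X by (cases "k \<in> K") auto
  qed
  have "(\<lambda>\<omega>. ?G (\<lambda>k. if k \<in> K then X k \<omega> else 0)) \<in> borel_measurable M" by measurable
  then show ?thesis by (simp cong: sum.cong)
qed

lemma power2_le_1_plus_power3: "x\<^sup>2 \<le> 1 + \<bar>x\<bar> ^ 3" for x :: real
proof (cases "\<bar>x\<bar> \<le> 1")
  case True
  then have "x\<^sup>2 \<le> 1" by (simp add: abs_square_le_1)
  then show ?thesis by (smt (verit) zero_le_power abs_ge_zero)
next
  case False
  then have "\<bar>x\<bar> ^ 2 \<le> \<bar>x\<bar> ^ 3" by (intro power_increasing) auto
  then show ?thesis by simp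
qed

lemma abs_le_1_plus_power3: "\<bar>x\<bar> \<le> 1 + \<bar>x\<bar> ^ 3" for x :: real
proof (cases "\<bar>x\<bar> \<le> 1")
  case True
  then show ?thesis by (smt (verit) zero_le_power abs_ge_zero)
next
  case False
  then have "\<bar>x\<bar> ^ 1 \<le> \<bar>x\<bar> ^ 3" by (intro power_increasing) auto
  then show ?thesis by simp
qed

lemma (in prob_space) integrable_moments:
  fixes X :: "'a \<Rightarrow> real"
  assumes [measurable]: "X \<in> borel_measurable M" and "integrable M (\<lambda>x. \<bar>X x\<bar> ^ 3)"
  shows "integrable M X" "integrable M (\<lambda>x. (X x)\<^sup>2)"
proof -
  have i: "integrable M (\<lambda>x. 1 + \<bar>X x\<bar> ^ 3)" using assms by simp
  show "integrable M X"
    by (rule Bochner_Integration.integrable_bound[OF i])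
      (use abs_le_1_plus_power3 in \<open>auto simp: abs_of_nonneg\<close>)
  show "integrable M (\<lambda>x. (X x)\<^sup>2)"
    by (rule Bochner_Integration.integrable_bound[OF i])
      (use power2_le_1_plus_power3 in \<open>auto simp: abs_of_nonneg\<close>)
qed

text \<open>Cauchy-Schwarz bounds the squared norm of the sum by the sum of the squared coefficients
  times a constant. Only second moments enter, and no independence.\<close>

lemma integrable_quadratic_growth:
  fixes g :: "'v::real_normed_vector \<Rightarrow> real" and h :: "'i::countable \<Rightarrow> 'v"
  assumes M: "prob_space M" and K: "finite K"
    and g: "continuous_on UNIV g" and growth: "\<And>w. \<bar>g w\<bar> \<le> C * (1 + (norm w)\<^sup>2)"
    and X: "\<And>k. k \<in> K \<Longrightarrow> X k \<in> borel_measurable M"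
    and int: "\<And>k. k \<in> K \<Longrightarrow> integrable M (\<lambda>\<omega>. (X k \<omega>)\<^sup>2)"
  shows "integrable M (\<lambda>\<omega>. g (\<Sum>k\<in>K. X k \<omega> *\<^sub>R h k))"
proof -
  interpret prob_space M by fact
  let ?c = "\<Sum>k\<in>K. (norm (h k))\<^sup>2"
  have C: "0 \<le> C" using growth[of 0] by (simp add: abs_le_iff)
  have "integrable M (\<lambda>\<omega>. C * (1 + (\<Sum>k\<in>K. (X k \<omega>)\<^sup>2) * ?c))"
    using int by (intro integrable_mult_right integrable_add integrable_mult_left integrable_sum) auto
  then show ?thesis
  proof (rule Bochner_Integration.integrable_bound)
    show "(\<lambda>\<omega>. g (\<Sum>k\<in>K. X k \<omega> *\<^sub>R h k)) \<in> borel_measurable M"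
      by (rule borel_measurable_linear_combination[OF g X])
    show "AE \<omega> in M. norm (g (\<Sum>k\<in>K. X k \<omega> *\<^sub>R h k)) \<le> norm (C * (1 + (\<Sum>k\<in>K. (X k \<omega>)\<^sup>2) * ?c))"
    proof (intro AE_I2)
      fix \<omega>
      have "norm (\<Sum>k\<in>K. X k \<omega> *\<^sub>R h k) \<le> (\<Sum>k\<in>K. \<bar>X k \<omega>\<bar> * norm (h k))"
        by (rule order_trans[OF norm_sum]) simp
      then have "(norm (\<Sum>k\<in>K. X k \<omega> *\<^sub>R h k))\<^sup>2 \<le> (\<Sum>k\<in>K. \<bar>X k \<omega>\<bar> * norm (h k))\<^sup>2"
        by (intro power_mono) auto
      also have "\<dots> \<le> (\<Sum>k\<in>K. \<bar>X k \<omega>\<bar>\<^sup>2) * ?c" by (rule Cauchy_Schwarz_ineq_sum)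
      finally have "C * (1 + (norm (\<Sum>k\<in>K. X k \<omega> *\<^sub>R h k))\<^sup>2) \<le> C * (1 + (\<Sum>k\<in>K. (X k \<omega>)\<^sup>2) * ?c)"
        using C by (intro mult_left_mono) auto
      then show "norm (g (\<Sum>k\<in>K. X k \<omega> *\<^sub>R h k)) \<le> norm (C * (1 + (\<Sum>k\<in>K. (X k \<omega>)\<^sup>2) * ?c))"
        using growth[of "\<Sum>k\<in>K. X k \<omega> *\<^sub>R h k"] by simp
    qed
  qed
qed

text \<open>Up to an error in the third absolute moment, the integral depends on \<open>M\<close>
  only through its first two moments. Two measures with matching moments thus share the main
  term.\<close>

lemma integral_quadratic_approximation:
  fixes \<phi> :: "real \<Rightarrow> real"
  assumes M: "prob_space M" "sets M = sets borel" "integrable M (\<lambda>x. \<bar>x\<bar> ^ 3)"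
    and int: "integrable M \<phi>"
    and \<phi>: "\<And>x. \<bar>\<phi> x - c - a * x - b * x\<^sup>2\<bar> \<le> A * \<bar>x\<bar> ^ 3"
  shows "\<bar>(\<integral>x. \<phi> x \<partial>M) - (c + a * (\<integral>x. x \<partial>M) + b * (\<integral>x. x\<^sup>2 \<partial>M))\<bar> \<le> A * (\<integral>x. \<bar>x\<bar> ^ 3 \<partial>M)"
proof -
  interpret prob_space M by fact
  have "(\<lambda>x. x) \<in> borel_measurable M" using M(2) by (simp cong: measurable_cong_sets)
  note i = integrable_moments[OF this M(3)]
  have "(\<integral>x. \<phi> x \<partial>M) - (c + a * (\<integral>x. x \<partial>M) + b * (\<integral>x. x\<^sup>2 \<partial>M))
      = (\<integral>x. \<phi> x - c - a * x - b * x\<^sup>2 \<partial>M)"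
    using i int by (simp add: prob_space algebra_simps)
  also have "\<bar>\<dots>\<bar> \<le> (\<integral>x. A * \<bar>x\<bar> ^ 3 \<partial>M)"
    using i int M(3) \<phi>
    by (intro order_trans[OF integral_abs_bound] integral_mono) auto
  finally show ?thesis by simp
qed

section \<open>Replacement of coordinates in product measures\<close>

lemma abs_integral_diff_le:
  fixes f g :: "'a \<Rightarrow> real"
  assumes "prob_space M" "integrable M f" "integrable M g" "\<And>x. x \<in> space M \<Longrightarrow> \<bar>f x - g x\<bar> \<le> c"
  shows "\<bar>(\<integral>x. f x \<partial>M) - (\<integral>x. g x \<partial>M)\<bar> \<le> c"
proof -
  interpret prob_space M by fact
  have "\<bar>(\<integral>x. f x \<partial>M) - (\<integral>x. g x \<partial>M)\<bar> = \<bar>\<integral>x. f x - g x \<partial>M\<bar>" using assms by simp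
  also have "\<dots> \<le> (\<integral>x. \<bar>f x - g x\<bar> \<partial>M)" by (rule integral_abs_bound)
  also have "\<dots> \<le> c"
    using assms by (intro integral_le_const) auto
  finally show ?thesis .
qed

lemma integrable_PiM_component_power:
  fixes M :: "'i \<Rightarrow> real measure"
  assumes M: "\<And>k. prob_space (M k)" "\<And>k. sets (M k) = sets borel"
      "\<And>k. integrable (M k) (\<lambda>x. \<bar>x\<bar> ^ 3)" and k: "k \<in> K"
  shows "integrable (PiM K M) (\<lambda>x. (x k)\<^sup>2)" "(\<lambda>x. x k) \<in> borel_measurable (PiM K M)"
proof -
  have m: "(\<lambda>x. x k) \<in> measurable (PiM K M) (M k)" using k by (rule measurable_component_singleton)
  interpret prob_space "M k" by fact
  have b: "(\<lambda>x. x) \<in> borel_measurable (M k)" using M(2) by (simp cong: measurable_cong_sets)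
  have "integrable (distr (PiM K M) (M k) (\<lambda>x. x k)) (\<lambda>x. x\<^sup>2)"
    using integrable_moments(2)[OF b M(3)] M(1) k by (subst distr_PiM_component) auto
  then show "integrable (PiM K M) (\<lambda>x. (x k)\<^sup>2)"
    using m b by (subst (asm) integrable_distr_eq) auto
  show "(\<lambda>x. x k) \<in> borel_measurable (PiM K M)" using measurable_compose[OF m b] .
qed

lemma lindeberg_swap_one:
  fixes g :: "'v::real_normed_vector \<Rightarrow> real" and h :: "'i::countable \<Rightarrow> 'v"
    and M N :: "'i \<Rightarrow> real measure"
  assumes K: "finite K" "j \<notin> K"
    and g: "continuous_on UNIV g" and growth: "\<And>w. \<bar>g w\<bar> \<le> C * (1 + (norm w)\<^sup>2)"
    and approx: "\<And>w. \<exists>a b. \<forall>x. \<bar>g (w + x *\<^sub>R h j) - g w - a * x - b * x\<^sup>2\<bar> \<le> A * \<bar>x\<bar> ^ 3"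
    and M: "\<And>k. prob_space (M k)" "\<And>k. sets (M k) = sets borel"
      "\<And>k. integrable (M k) (\<lambda>x. \<bar>x\<bar> ^ 3)"
    and N: "\<And>k. prob_space (N k)" "\<And>k. sets (N k) = sets borel"
      "\<And>k. integrable (N k) (\<lambda>x. \<bar>x\<bar> ^ 3)"
    and same: "\<And>k. k \<in> K \<Longrightarrow> M k = N k"
    and mean: "(\<integral>x. x \<partial>M j) = (\<integral>x. x \<partial>N j)" and var: "(\<integral>x. x\<^sup>2 \<partial>M j) = (\<integral>x. x\<^sup>2 \<partial>N j)"
  shows "\<bar>(\<integral>x. g (\<Sum>k\<in>insert j K. x k *\<^sub>R h k) \<partial>PiM (insert j K) M)
         - (\<integral>x. g (\<Sum>k\<in>insert j K. x k *\<^sub>R h k) \<partial>PiM (insert j K) N)\<bar>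
         \<le> A * ((\<integral>x. \<bar>x\<bar> ^ 3 \<partial>M j) + (\<integral>x. \<bar>x\<bar> ^ 3 \<partial>N j))"
proof -
  let ?s = "\<lambda>x. \<Sum>k\<in>K. x k *\<^sub>R h k"
  have main: "(\<integral>x. g (\<Sum>k\<in>insert j K. x k *\<^sub>R h k) \<partial>PiM (insert j K) L)
       = (\<integral>x. (\<integral>y. g (?s x + y *\<^sub>R h j) \<partial>L j) \<partial>PiM K L)"
     "integrable (PiM K L) (\<lambda>x. (\<integral>y. g (?s x + y *\<^sub>R h j) \<partial>L j))"
    if L: "\<And>k. prob_space (L k)" "\<And>k. sets (L k) = sets borel" "\<And>k. integrable (L k) (\<lambda>x. \<bar>x\<bar> ^ 3)"
    for L
  proof -
    interpret L: product_prob_space L using L(1) by (rule product_prob_spaceI)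
    have int: "integrable (PiM (insert j K) L) (\<lambda>x. g (\<Sum>k\<in>insert j K. x k *\<^sub>R h k))"
      using K L integrable_PiM_component_power[of L, OF L]
      by (intro integrable_quadratic_growth[OF _ _ g growth] prob_space_PiM) auto
    have eq: "(\<Sum>k\<in>insert j K. (x(j := y)) k *\<^sub>R h k) = ?s x + y *\<^sub>R h j" for x y
      using K by (simp add: add.commute) (rule sum.cong, auto)
    show "(\<integral>x. g (\<Sum>k\<in>insert j K. x k *\<^sub>R h k) \<partial>PiM (insert j K) L)
       = (\<integral>x. (\<integral>y. g (?s x + y *\<^sub>R h j) \<partial>L j) \<partial>PiM K L)"
      unfolding L.product_integral_insert[OF K int] eq ..
    interpret PK: prob_space "PiM K L" using L by (intro prob_space_PiM) auto
    have Lj: "prob_space (L j)" using L by auto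
    then have "sigma_finite_measure (L j)" by (rule prob_space_imp_sigma_finite)
    then have pair: "pair_sigma_finite (PiM K L) (L j)" and pair': "pair_sigma_finite (L j) (PiM K L)"
      using PK.sigma_finite_measure_axioms by (auto simp: pair_sigma_finite_def)
    \<comment> \<open>\<open>?q\<close> reads a point of the pair space as a family of coefficients
      indexed by \<open>insert j K\<close>. The growth lemma then gives integrability on the pair
      space, and Fubini gives it for the inner integral.\<close>
    let ?q = "\<lambda>k::'i. \<lambda>z::('i \<Rightarrow> real) \<times> real. if k = j then snd z else fst z k"
    have "integrable (PiM K L \<Otimes>\<^sub>M L j) (\<lambda>z. g (\<Sum>k\<in>insert j K. ?q k z *\<^sub>R h k))"
    proof (rule integrable_quadratic_growth[OF _ _ g growth])
      show "prob_space (PiM K L \<Otimes>\<^sub>M L j)"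
        by (rule prob_space_pair[OF PK.prob_space_axioms Lj])
      show "finite (insert j K)" using K by simp
      fix k assume k: "k \<in> insert j K"
      have b: "(\<lambda>x. x) \<in> borel_measurable (L j)" using L(2) by (simp cong: measurable_cong_sets)
      have i2: "integrable (L j) (\<lambda>x. x\<^sup>2)" using prob_space.integrable_moments[OF L(1) b L(3)] by simp
      show "?q k \<in> borel_measurable (PiM K L \<Otimes>\<^sub>M L j)"
        using k measurable_compose[OF measurable_snd b, of "PiM K L"]
          measurable_compose[OF measurable_fst integrable_PiM_component_power(2)[of L, OF L, of k K], of "L j"]
        by (cases "k = j") auto
      show "integrable (PiM K L \<Otimes>\<^sub>M L j) (\<lambda>\<omega>. (?q k \<omega>)\<^sup>2)"
      proof (cases "k = j")
        case True
        have "integrable (distr (L j \<Otimes>\<^sub>M PiM K L) (L j) fst) (\<lambda>x. x\<^sup>2)"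
          using i2 by (subst prob_space.distr_pair_fst[OF PK.prob_space_axioms]) auto
        then have "integrable (L j \<Otimes>\<^sub>M PiM K L) (\<lambda>z. (fst z)\<^sup>2)"
          using b by (subst (asm) integrable_distr_eq) auto
        then have "integrable (PiM K L \<Otimes>\<^sub>M L j) (\<lambda>(x, y). (fst (y, x))\<^sup>2)"
          by (rule pair_sigma_finite.integrable_product_swap[OF pair'])
        then show ?thesis using True by (simp add: case_prod_unfold)
      next
        case False
        then have kK: "k \<in> K" using k by simp
        have "integrable (distr (PiM K L \<Otimes>\<^sub>M L j) (PiM K L) fst) (\<lambda>x. (x k)\<^sup>2)"
          using integrable_PiM_component_power(1)[of L, OF L kK] by (subst prob_space.distr_pair_fst[OF Lj]) auto
        then show ?thesis using False integrable_PiM_component_power(2)[of L, OF L kK]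
          by (subst (asm) integrable_distr_eq) auto
      qed
    qed
    moreover have "(\<Sum>k\<in>insert j K. ?q k z *\<^sub>R h k) = ?s (fst z) + snd z *\<^sub>R h j" for z
      using K by (simp add: add.commute) (rule sum.cong, auto)
    ultimately have "integrable (PiM K L \<Otimes>\<^sub>M L j) (\<lambda>z. g (?s (fst z) + snd z *\<^sub>R h j))"
      by simp
    then show "integrable (PiM K L) (\<lambda>x. (\<integral>y. g (?s x + y *\<^sub>R h j) \<partial>L j))"
      using pair_sigma_finite.integrable_fst'[OF pair, of "\<lambda>z. g (?s (fst z) + snd z *\<^sub>R h j)"] by simp
  qed
  have PK: "PiM K M = PiM K N" using same by (intro PiM_cong) auto
  have int1: "integrable (L j) (\<lambda>y. g (w + y *\<^sub>R h j))"
    if L: "\<And>k. prob_space (L k)" "\<And>k. sets (L k) = sets borel" "\<And>k. integrable (L k) (\<lambda>x. \<bar>x\<bar> ^ 3)"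
    for L w
  proof -
    interpret prob_space "L j" by fact
    have b: "(\<lambda>x. x) \<in> borel_measurable (L j)" using L(2) by (simp cong: measurable_cong_sets)
    \<comment> \<open>The affine argument becomes a linear combination over the index type
      \<open>bool\<close>, with the constant coefficient 1 in front of \<open>w\<close>.\<close>
    have "integrable (L j) (\<lambda>y. g (\<Sum>k\<in>{False, True}. (if k then y else 1) *\<^sub>R (if k then h j else w)))"
    proof (intro integrable_quadratic_growth[OF _ _ g growth] L(1))
      fix k
      show "(\<lambda>y. if k then y else 1) \<in> borel_measurable (L j)" using b by (cases k) simp_all
      show "integrable (L j) (\<lambda>y. (if k then y else 1)\<^sup>2)"
        using integrable_moments(2)[OF b L(3)] by (cases k) simp_all
    qed simp
    then show ?thesis by simp
  qed
  show ?thesis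
    unfolding main(1)[of M, OF M] main(1)[of N, OF N] PK
  proof (rule abs_integral_diff_le)
    show "prob_space (PiM K N)" using N by (intro prob_space_PiM) auto
    show "integrable (PiM K N) (\<lambda>x. (\<integral>y. g (?s x + y *\<^sub>R h j) \<partial>M j))"
      using main(2)[of M, OF M] by (simp add: PK)
    show "integrable (PiM K N) (\<lambda>x. (\<integral>y. g (?s x + y *\<^sub>R h j) \<partial>N j))" by (rule main(2)[of N, OF N])
    fix x
    obtain a b where ab: "\<And>y. \<bar>g (?s x + y *\<^sub>R h j) - g (?s x) - a * y - b * y\<^sup>2\<bar> \<le> A * \<bar>y\<bar> ^ 3"
      using approx by blast
    show "\<bar>(\<integral>y. g (?s x + y *\<^sub>R h j) \<partial>M j) - (\<integral>y. g (?s x + y *\<^sub>R h j) \<partial>N j)\<bar>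
       \<le> A * ((\<integral>x. \<bar>x\<bar> ^ 3 \<partial>M j) + (\<integral>x. \<bar>x\<bar> ^ 3 \<partial>N j))"
      using integral_quadratic_approximation[OF M int1[of M, OF M] ab]
        integral_quadratic_approximation[OF N int1[of N, OF N] ab]
      unfolding mean var distrib_left by linarith
  qed
qed

text \<open>The coordinates are exchanged one at a time and the errors add up, by induction on the
  set of coordinates already exchanged.\<close>

lemma lindeberg_PiM:
  fixes g :: "'v::real_normed_vector \<Rightarrow> real" and h :: "'i::countable \<Rightarrow> 'v"
    and M N :: "'i \<Rightarrow> real measure"
  assumes K: "finite K"
    and g: "continuous_on UNIV g" and growth: "\<And>w. \<bar>g w\<bar> \<le> C * (1 + (norm w)\<^sup>2)"
    and approx: "\<And>k w. k \<in> K \<Longrightarrow>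
      \<exists>a b. \<forall>x. \<bar>g (w + x *\<^sub>R h k) - g w - a * x - b * x\<^sup>2\<bar> \<le> A k * \<bar>x\<bar> ^ 3"
    and M: "\<And>k. prob_space (M k)" "\<And>k. sets (M k) = sets borel"
      "\<And>k. integrable (M k) (\<lambda>x. \<bar>x\<bar> ^ 3)"
    and N: "\<And>k. prob_space (N k)" "\<And>k. sets (N k) = sets borel"
      "\<And>k. integrable (N k) (\<lambda>x. \<bar>x\<bar> ^ 3)"
    and mean: "\<And>k. k \<in> K \<Longrightarrow> (\<integral>x. x \<partial>M k) = (\<integral>x. x \<partial>N k)"
    and var: "\<And>k. k \<in> K \<Longrightarrow> (\<integral>x. x\<^sup>2 \<partial>M k) = (\<integral>x. x\<^sup>2 \<partial>N k)"
  shows "\<bar>(\<integral>x. g (\<Sum>k\<in>K. x k *\<^sub>R h k) \<partial>PiM K M) - (\<integral>x. g (\<Sum>k\<in>K. x k *\<^sub>R h k) \<partial>PiM K N)\<bar>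
         \<le> (\<Sum>k\<in>K. A k * ((\<integral>x. \<bar>x\<bar> ^ 3 \<partial>M k) + (\<integral>x. \<bar>x\<bar> ^ 3 \<partial>N k)))"
proof -
  \<comment> \<open>Hybrid family with the coordinates in \<open>J\<close> already exchanged.
    Enlarging \<open>J\<close> by \<open>j\<close> changes it at \<open>j\<close> alone.\<close>
  let ?L = "\<lambda>J k. if k \<in> J then N k else M k"
  let ?E = "\<lambda>L. \<integral>x. g (\<Sum>k\<in>K. x k *\<^sub>R h k) \<partial>PiM K L"
  have "\<bar>?E M - ?E (?L J)\<bar> \<le> (\<Sum>k\<in>J. A k * ((\<integral>x. \<bar>x\<bar> ^ 3 \<partial>M k) + (\<integral>x. \<bar>x\<bar> ^ 3 \<partial>N k)))"
    if "finite J" "J \<subseteq> K" for J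
    using that
  proof (induction J rule: finite_induct)
    case empty
    then show ?case by simp
  next
    case (insert j J)
    have Kj: "insert j (K - {j}) = K" using insert by auto
    have "\<bar>?E (?L J) - ?E (?L (insert j J))\<bar>
        \<le> A j * ((\<integral>x. \<bar>x\<bar> ^ 3 \<partial>(?L J j)) + (\<integral>x. \<bar>x\<bar> ^ 3 \<partial>(?L (insert j J) j)))"
      using insert K M N mean var
      by (intro lindeberg_swap_one[where K = "K - {j}" and j = j, unfolded Kj, OF _ _ g growth approx]) auto
    then have "\<bar>?E (?L J) - ?E (?L (insert j J))\<bar>
        \<le> A j * ((\<integral>x. \<bar>x\<bar> ^ 3 \<partial>M j) + (\<integral>x. \<bar>x\<bar> ^ 3 \<partial>N j))" using insert by simp
    moreover have "\<bar>?E M - ?E (?L J)\<bar>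
        \<le> (\<Sum>k\<in>J. A k * ((\<integral>x. \<bar>x\<bar> ^ 3 \<partial>M k) + (\<integral>x. \<bar>x\<bar> ^ 3 \<partial>N k)))"
      using insert by auto
    moreover have "(\<Sum>k\<in>insert j J. A k * ((\<integral>x. \<bar>x\<bar> ^ 3 \<partial>M k) + (\<integral>x. \<bar>x\<bar> ^ 3 \<partial>N k)))
        = A j * ((\<integral>x. \<bar>x\<bar> ^ 3 \<partial>M j) + (\<integral>x. \<bar>x\<bar> ^ 3 \<partial>N j))
          + (\<Sum>k\<in>J. A k * ((\<integral>x. \<bar>x\<bar> ^ 3 \<partial>M k) + (\<integral>x. \<bar>x\<bar> ^ 3 \<partial>N k)))"
      using insert by simp
    ultimately show ?case by linarith
  qed
  from this[OF K order_refl] show ?thesis by (simp cong: PiM_cong)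
qed

lemma (in prob_space) integral_eq_PiM_distr:
  fixes g :: "'v::real_normed_vector \<Rightarrow> real" and h :: "'i::countable \<Rightarrow> 'v"
  assumes K: "finite K" "K \<noteq> {}" and g: "continuous_on UNIV g"
    and X: "indep_vars (\<lambda>_. borel) X K"
  shows "expectation (\<lambda>\<omega>. g (\<Sum>k\<in>K. X k \<omega> *\<^sub>R h k))
    = (\<integral>x. g (\<Sum>k\<in>K. x k *\<^sub>R h k) \<partial>PiM K (\<lambda>k. distr M borel (X k)))"
proof -
  have rv: "\<And>k. k \<in> K \<Longrightarrow> random_variable borel (X k)" using X by (auto simp: indep_vars_def)
  have "PiM K (\<lambda>k. distr M borel (X k)) = distr M (PiM K (\<lambda>_. borel)) (\<lambda>\<omega>. \<lambda>k\<in>K. X k \<omega>)"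
    using indep_vars_iff_distr_eq_PiM'[OF K(2) rv] X by simp
  then have "(\<integral>x. g (\<Sum>k\<in>K. x k *\<^sub>R h k) \<partial>PiM K (\<lambda>k. distr M borel (X k)))
     = (\<integral>x. g (\<Sum>k\<in>K. x k *\<^sub>R h k) \<partial>distr M (PiM K (\<lambda>_. borel)) (\<lambda>\<omega>. \<lambda>k\<in>K. X k \<omega>))"
    by simp
  also have "\<dots> = expectation (\<lambda>\<omega>. g (\<Sum>k\<in>K. (\<lambda>k\<in>K. X k \<omega>) k *\<^sub>R h k))"
    using rv by (intro integral_distr measurable_restrict borel_measurable_linear_combination[OF g]) auto
  finally show ?thesis by (simp cong: sum.cong)
qed

lemma lindeberg:
  fixes g :: "'v::real_normed_vector \<Rightarrow> real" and h :: "'i::countable \<Rightarrow> 'v"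
    and P :: "'a measure" and Q :: "'b measure"
  assumes K: "finite K" "K \<noteq> {}"
    and g: "continuous_on UNIV g" and growth: "\<And>w. \<bar>g w\<bar> \<le> C * (1 + (norm w)\<^sup>2)"
    and approx: "\<And>k w. k \<in> K \<Longrightarrow>
      \<exists>a b. \<forall>x. \<bar>g (w + x *\<^sub>R h k) - g w - a * x - b * x\<^sup>2\<bar> \<le> A k * \<bar>x\<bar> ^ 3"
    and P: "prob_space P" and X: "prob_space.indep_vars P (\<lambda>_. borel) X K"
      "\<And>k. k \<in> K \<Longrightarrow> integrable P (\<lambda>\<omega>. \<bar>X k \<omega>\<bar> ^ 3)"
    and Q: "prob_space Q" and Y: "prob_space.indep_vars Q (\<lambda>_. borel) Y K"
      "\<And>k. k \<in> K \<Longrightarrow> integrable Q (\<lambda>\<omega>. \<bar>Y k \<omega>\<bar> ^ 3)"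
    and mean: "\<And>k. k \<in> K \<Longrightarrow> (\<integral>\<omega>. X k \<omega> \<partial>P) = (\<integral>\<omega>. Y k \<omega> \<partial>Q)"
    and var: "\<And>k. k \<in> K \<Longrightarrow> (\<integral>\<omega>. (X k \<omega>)\<^sup>2 \<partial>P) = (\<integral>\<omega>. (Y k \<omega>)\<^sup>2 \<partial>Q)"
  shows "\<bar>(\<integral>\<omega>. g (\<Sum>k\<in>K. X k \<omega> *\<^sub>R h k) \<partial>P) - (\<integral>\<omega>. g (\<Sum>k\<in>K. Y k \<omega> *\<^sub>R h k) \<partial>Q)\<bar>
         \<le> (\<Sum>k\<in>K. A k * ((\<integral>\<omega>. \<bar>X k \<omega>\<bar> ^ 3 \<partial>P) + (\<integral>\<omega>. \<bar>Y k \<omega>\<bar> ^ 3 \<partial>Q)))"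
proof -
  interpret P: prob_space P by fact
  interpret Q: prob_space Q by fact
  have rv: "X k \<in> borel_measurable P" "Y k \<in> borel_measurable Q" if "k \<in> K" for k
    using X(1) Y(1) that by (auto simp: P.indep_vars_def Q.indep_vars_def)
  \<comment> \<open>The constant 0 outside \<open>K\<close> gives a probability measure with finite
    third moment at every index, as product families over the whole index type require.\<close>
  define M where "M k = distr P borel (if k \<in> K then X k else (\<lambda>_. 0))" for k
  define N where "N k = distr Q borel (if k \<in> K then Y k else (\<lambda>_. 0))" for k
  have M: "prob_space (M k)" "sets (M k) = sets borel" "integrable (M k) (\<lambda>x. \<bar>x\<bar> ^ 3)" for k
    using rv X(2) by (auto simp: M_def integrable_distr_eq intro!: P.prob_space_distr prob_space_return)
  have N: "prob_space (N k)" "sets (N k) = sets borel" "integrable (N k) (\<lambda>x. \<bar>x\<bar> ^ 3)" for k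
    using rv Y(2) by (auto simp: N_def integrable_distr_eq intro!: Q.prob_space_distr prob_space_return)
  have "(\<integral>\<omega>. g (\<Sum>k\<in>K. X k \<omega> *\<^sub>R h k) \<partial>P) = (\<integral>x. g (\<Sum>k\<in>K. x k *\<^sub>R h k) \<partial>PiM K M)"
    unfolding P.integral_eq_PiM_distr[OF K g X(1)] by (simp add: M_def cong: PiM_cong)
  moreover have "(\<integral>\<omega>. g (\<Sum>k\<in>K. Y k \<omega> *\<^sub>R h k) \<partial>Q) = (\<integral>x. g (\<Sum>k\<in>K. x k *\<^sub>R h k) \<partial>PiM K N)"
    unfolding Q.integral_eq_PiM_distr[OF K g Y(1)] by (simp add: N_def cong: PiM_cong)
  moreover have "\<bar>(\<integral>x. g (\<Sum>k\<in>K. x k *\<^sub>R h k) \<partial>PiM K M) - (\<integral>x. g (\<Sum>k\<in>K. x k *\<^sub>R h k) \<partial>PiM K N)\<bar>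
      \<le> (\<Sum>k\<in>K. A k * ((\<integral>x. \<bar>x\<bar> ^ 3 \<partial>M k) + (\<integral>x. \<bar>x\<bar> ^ 3 \<partial>N k)))"
    using mean var
    by (intro lindeberg_PiM[OF K(1) g growth approx M N]) (simp_all add: M_def N_def integral_distr rv)
  moreover have "\<dots> = (\<Sum>k\<in>K. A k * ((\<integral>\<omega>. \<bar>X k \<omega>\<bar> ^ 3 \<partial>P) + (\<integral>\<omega>. \<bar>Y k \<omega>\<bar> ^ 3 \<partial>Q)))"
    by (intro sum.cong refl) (simp add: M_def N_def integral_distr rv)
  ultimately show ?thesis by simp
qed

section \<open>Modulus of continuity of Brownian motion\<close>

text \<open>Cauchy-Schwarz against the weights (3/4)^(j+1), whose sum is at most 3. It trades a sum
  of square roots for a weighted sum that is linear in \<open>H\<close>, so that expectations can be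
  taken term by term.\<close>

lemma sum_le_of_geometric_weights:
  fixes H :: "nat \<Rightarrow> real"
  assumes H: "\<And>j. 0 \<le> H j" and U: "(\<Sum>j<J. (4/3) ^ Suc j * H j) \<le> U"
  shows "(\<Sum>j<J. sqrt (H j)) \<le> sqrt (3 * U)"
proof (rule real_le_rsqrt)
  have "(\<Sum>j<J. (3/4::real) ^ Suc j) = 3/4 * (\<Sum>j<J. (3/4) ^ j)"
    by (simp add: sum_distrib_left)
  also have "\<dots> = 3 * (1 - (3/4) ^ J)" by (subst sum_gp_strict) simp
  also have "\<dots> \<le> 3" by simp
  finally have g: "(\<Sum>j<J. (3/4::real) ^ Suc j) \<le> 3" .
  have "(\<Sum>j<J. sqrt (H j))\<^sup>2 = (\<Sum>j<J. sqrt ((3/4) ^ Suc j) * sqrt ((4/3) ^ Suc j * H j))\<^sup>2"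
    by (simp flip: real_sqrt_mult power_mult_distrib mult.assoc)
  also have "\<dots> \<le> (\<Sum>j<J. (sqrt ((3/4) ^ Suc j))\<^sup>2) * (\<Sum>j<J. (sqrt ((4/3) ^ Suc j * H j))\<^sup>2)"
    by (rule Cauchy_Schwarz_ineq_sum)
  also have "\<dots> = (\<Sum>j<J. (3/4) ^ Suc j) * (\<Sum>j<J. (4/3) ^ Suc j * H j)"
    using H by (simp del: power_Suc)
  also have "\<dots> \<le> 3 * U"
    using g U H by (intro mult_mono sum_nonneg) (auto simp del: power_Suc)
  finally show "(\<Sum>j<J. sqrt (H j))\<^sup>2 \<le> 3 * U" .
qed

text \<open>The point \<open>s\<close> is approached by its left neighbours \<open>q j\<close> in
  the grids of mesh 1/(N 2^j). Each refinement costs at most one increment between neighbours, and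
  continuity of \<open>f\<close> gives the limit.\<close>

lemma chaining:
  fixes f :: "real \<Rightarrow> real" and H :: "nat \<Rightarrow> real"
  assumes N: "N > 0" and cont: "continuous_on {0..1} f"
    and H: "\<And>j k. k < N * 2 ^ Suc j \<Longrightarrow>
      (f (real (Suc k) / real (N * 2 ^ Suc j)) - f (real k / real (N * 2 ^ Suc j)))\<^sup>2 \<le> H j"
    and U: "\<And>J. (\<Sum>j<J. (4/3) ^ Suc j * H j) \<le> U"
    and s: "s \<in> {0..1}"
  shows "\<bar>f s - f (real (nat \<lfloor>real N * s\<rfloor>) / real N)\<bar> \<le> sqrt (3 * U)"
proof -
  have H0: "0 \<le> H j" for j
    using order_trans[OF zero_le_power2 H[of 0 j]] N by simp
  define d where "d j = nat \<lfloor>real (N * 2 ^ j) * s\<rfloor>" for j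
  define q where "q j = real (d j) / real (N * 2 ^ j)" for j
  have d: "real (d j) \<le> real (N * 2 ^ j) * s" "real (N * 2 ^ j) * s < real (d j) + 1" for j
    using s N unfolding d_def by (auto simp: of_nat_nat)
  have d_le: "d j \<le> N * 2 ^ j" for j
  proof -
    have "real (N * 2 ^ j) * s \<le> real (N * 2 ^ j) * 1" using s by (intro mult_left_mono) auto
    then show ?thesis using d(1)[of j] by linarith
  qed
  have step: "\<bar>f (q (Suc j)) - f (q j)\<bar> \<le> sqrt (H j)" for j
  proof -
    have e: "real (N * 2 ^ Suc j) * s = 2 * (real (N * 2 ^ j) * s)" by simp
    \<comment> \<open>Doubling the argument of a floor gives twice the floor or one more, so
      consecutive \<open>q\<close> coincide or are neighbours in the finer grid.\<close>
    have "d (Suc j) = 2 * d j \<or> d (Suc j) = Suc (2 * d j)"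
      using d[of j] d[of "Suc j"] unfolding e by linarith
    moreover have "q j = real (2 * d j) / real (N * 2 ^ Suc j)" by (simp add: q_def)
    ultimately show ?thesis
    proof (elim disjE)
      assume "d (Suc j) = Suc (2 * d j)" and qj: "q j = real (2 * d j) / real (N * 2 ^ Suc j)"
      then have "(f (q (Suc j)) - f (q j))\<^sup>2 \<le> H j"
        unfolding qj using H[of "2 * d j" j] d_le[of "Suc j"] by (simp add: q_def)
      then show ?thesis by (rule real_le_rsqrt[of "\<bar>_\<bar>", simplified])
    qed (simp add: q_def H0)
  qed
  have "\<bar>f (q J) - f (q 0)\<bar> \<le> (\<Sum>j<J. sqrt (H j))" for J
  proof (induction J)
    case (Suc J)
    then show ?case using step[of J] by simp
  qed simp
  then have bound: "\<bar>f (q J) - f (q 0)\<bar> \<le> sqrt (3 * U)" for J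
    using sum_le_of_geometric_weights[OF H0 U, of J] by (rule order_trans)
  have "(\<lambda>J. s - 1 / real (N * 2 ^ J)) \<longlonglongrightarrow> s - 0"
  proof (intro tendsto_intros)
    have "(\<lambda>J. inverse (real N) * (1/2) ^ J) \<longlonglongrightarrow> inverse (real N) * 0"
      by (intro tendsto_intros LIMSEQ_realpow_zero) auto
    then show "(\<lambda>J. 1 / real (N * 2 ^ J)) \<longlonglongrightarrow> 0"
      by (simp add: field_simps power_divide)
  qed
  then have lim: "(\<lambda>J. s - 1 / real (N * 2 ^ J)) \<longlonglongrightarrow> s" by simp
  have "q \<longlonglongrightarrow> s"
  proof (rule tendsto_sandwich[OF _ _ lim tendsto_const])
    show "\<forall>\<^sub>F J in sequentially. s - 1 / real (N * 2 ^ J) \<le> q J"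
    proof (intro always_eventually allI)
      fix J
      have "s < (real (d J) + 1) / real (N * 2 ^ J)"
        using d(2)[of J] N by (simp add: pos_less_divide_eq mult.commute del: of_nat_mult)
      then show "s - 1 / real (N * 2 ^ J) \<le> q J" by (simp add: q_def add_divide_distrib)
    qed
    show "\<forall>\<^sub>F J in sequentially. q J \<le> s"
      using d(1) N by (intro always_eventually) (auto simp: q_def field_simps)
  qed
  moreover have "q J \<in> {0..1}" for J
  proof -
    have "real (d J) \<le> real (N * 2 ^ J)" using d_le[of J] by (simp only: of_nat_le_iff)
    then have "q J \<le> 1" using N by (simp add: q_def divide_le_eq_1 del: of_nat_mult)
    then show ?thesis by (simp add: q_def)
  qed
  ultimately have "(\<lambda>J. f (q J)) \<longlonglongrightarrow> f s"
    using cont s by (metis (no_types, lifting) continuous_on_sequentially comp_def ext)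
  then have "(\<lambda>J. \<bar>f (q J) - f (q 0)\<bar>) \<longlonglongrightarrow> \<bar>f s - f (q 0)\<bar>"
    by (intro tendsto_intros)
  then have "\<bar>f s - f (q 0)\<bar> \<le> sqrt (3 * U)"
    by (rule Lim_bounded) (use bound in auto)
  then show ?thesis by (simp add: q_def d_def)
qed

text \<open>For Gaussian \<open>x i\<close> of variance \<open>1/M\<close> the exponentials have bounded expectation, so that the
  right-hand side has expectation of order \<open>ln M / M\<close>.\<close>

lemma square_le_log_sum_exp:
  fixes x :: "nat \<Rightarrow> real"
  assumes k: "k < M"
  shows "(x k)\<^sup>2 \<le> 4 / real M * (ln (real M) - 1 + (\<Sum>i<M. exp (real M * (x i)\<^sup>2 / 4)) / real M)"
proof -
  have M: "0 < real M" using k by simp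
  define y where "y = real M * (x k)\<^sup>2 / 4"
  \<comment> \<open>The logarithm of the sum of exponentials is replaced by its tangent at
    \<open>M\<close>. The bound thereby becomes linear in the exponentials.\<close>
  have "1 + (y - ln (real M)) \<le> exp (y - ln (real M))" by (rule exp_ge_add_one_self)
  also have "\<dots> = exp y / real M" using M by (simp add: exp_diff)
  also have "exp y \<le> (\<Sum>i<M. exp (real M * (x i)\<^sup>2 / 4))"
    unfolding y_def using k
    by (intro member_le_sum[where f = "\<lambda>i. exp (real M * (x i)\<^sup>2 / 4)"]) auto
  finally have "y \<le> ln (real M) - 1 + (\<Sum>i<M. exp (real M * (x i)\<^sup>2 / 4)) / real M"
    using M by (simp add: divide_right_mono)
  then have "4 / real M * y \<le> 4 / real M * (ln (real M) - 1 + (\<Sum>i<M. exp (real M * (x i)\<^sup>2 / 4)) / real M)"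
    using M by (intro mult_left_mono) auto
  then show ?thesis using M by (simp add: y_def)
qed

text \<open>The exponents combine to -x^2/(4v), so the product is sqrt 2 times the density of
  variance 2v.\<close>

lemma normal_exp_square:
  assumes v: "v > 0"
  shows "has_bochner_integral lborel
    (\<lambda>x. normal_density 0 (sqrt v) x * exp (x\<^sup>2 / (4 * v))) (sqrt 2)"
proof -
  have *: "normal_density 0 (sqrt v) x * exp (x\<^sup>2 / (4 * v)) = sqrt 2 * normal_density 0 (sqrt (2 * v)) x" for x
  proof -
    have "exp (- x\<^sup>2 / (2 * v)) * exp (x\<^sup>2 / (4 * v)) = exp (- x\<^sup>2 / (4 * v))"
      using v by (simp add: field_simps flip: exp_add)
    then show ?thesis
      using v by (simp add: normal_density_def real_sqrt_mult field_simps)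
  qed
  have "has_bochner_integral lborel (normal_density 0 (sqrt (2 * v))) 1"
    using v by (simp add: has_bochner_integral_iff)
  from has_bochner_integral_mult_right[OF this, of "sqrt 2"] show ?thesis
    by (simp add: *)
qed

text \<open>\<open>U\<close> is the infinite sum, integrable by monotone convergence. Where the sum
  is infinite, a null set, \<open>enn2real\<close> returns 0; hence the domination holds only almost
  everywhere.\<close>

lemma integrable_dominating_partial_sums:
  fixes f :: "nat \<Rightarrow> 'a \<Rightarrow> real"
  assumes f: "\<And>j. integrable M (f j)" "\<And>j \<omega>. 0 \<le> f j \<omega>"
    and c: "\<And>J. (\<Sum>j<J. \<integral>\<omega>. f j \<omega> \<partial>M) \<le> c"
  obtains U where "integrable M U" "\<And>\<omega>. 0 \<le> U \<omega>" "(\<integral>\<omega>. U \<omega> \<partial>M) \<le> c"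
    "AE \<omega> in M. \<forall>J. (\<Sum>j<J. f j \<omega>) \<le> U \<omega>"
proof -
  define V where "V \<omega> = (\<Sum>j. ennreal (f j \<omega>))" for \<omega>
  have [measurable]: "f j \<in> borel_measurable M" for j using f(1) by auto
  have [measurable]: "V \<in> borel_measurable M" unfolding V_def by measurable
  have c0: "0 \<le> c" using c[of 0] by simp
  have "(\<integral>\<^sup>+\<omega>. V \<omega> \<partial>M) = (\<Sum>j. \<integral>\<^sup>+\<omega>. ennreal (f j \<omega>) \<partial>M)"
    unfolding V_def by (rule nn_integral_suminf) measurable
  also have "\<dots> = (\<Sum>j. ennreal (\<integral>\<omega>. f j \<omega> \<partial>M))"
    using f by (simp add: nn_integral_eq_integral)
  also have "\<dots> \<le> ennreal c"
  proof (rule suminf_le_const)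
    fix J
    show "(\<Sum>j<J. ennreal (\<integral>\<omega>. f j \<omega> \<partial>M)) \<le> ennreal c"
      using c[of J] f by (subst sum_ennreal) (auto intro!: ennreal_leI)
  qed simp
  finally have V: "(\<integral>\<^sup>+\<omega>. V \<omega> \<partial>M) \<le> ennreal c" .
  then have "(\<integral>\<^sup>+\<omega>. V \<omega> \<partial>M) \<noteq> \<infinity>" by (auto simp: top_unique)
  then have fin: "AE \<omega> in M. V \<omega> \<noteq> \<infinity>" by (intro nn_integral_PInf_AE) auto
  have "(\<integral>\<^sup>+\<omega>. ennreal (enn2real (V \<omega>)) \<partial>M) = (\<integral>\<^sup>+\<omega>. V \<omega> \<partial>M)"
    using fin by (intro nn_integral_cong_AE) (auto simp: top.not_eq_extremum)
  then have le: "(\<integral>\<^sup>+\<omega>. ennreal (enn2real (V \<omega>)) \<partial>M) \<le> ennreal c" using V by simp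
  show thesis
  proof (rule that)
    show int: "integrable M (\<lambda>\<omega>. enn2real (V \<omega>))"
      using le by (intro integrableI_nonneg) (auto simp: less_top[symmetric] top_unique)
    show "(\<integral>\<omega>. enn2real (V \<omega>) \<partial>M) \<le> c"
      using le c0 nn_integral_eq_integral[OF int] by simp
    show "AE \<omega> in M. \<forall>J. (\<Sum>j<J. f j \<omega>) \<le> enn2real (V \<omega>)"
      using fin
    proof eventually_elim
      case (elim \<omega>)
      show ?case
      proof
        fix J
        have "ennreal (\<Sum>j<J. f j \<omega>) \<le> V \<omega>"
        proof -
          have "ennreal (\<Sum>j<J. f j \<omega>) = (\<Sum>j<J. ennreal (f j \<omega>))"
            by (rule sum_ennreal[symmetric]) (rule f(2))
          also have "\<dots> \<le> V \<omega>" unfolding V_def by (rule sum_le_suminf) auto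
          finally show ?thesis .
        qed
        then have "enn2real (ennreal (\<Sum>j<J. f j \<omega>)) \<le> enn2real (V \<omega>)"
          using elim by (intro enn2real_mono) (auto simp: top.not_eq_extremum)
        then show "(\<Sum>j<J. f j \<omega>) \<le> enn2real (V \<omega>)"
          using f(2) by (simp add: sum_nonneg)
      qed
    qed
  qed simp
qed

lemma sum_geometric_two_thirds: "(\<Sum>j<J. (2/3::real) ^ Suc j) \<le> 2"
proof -
  have "(\<Sum>j<J. (2/3::real) ^ Suc j) = 2 - 2 * (2/3) ^ J"
    by (induction J) auto
  then show ?thesis by simp
qed

lemma sum_arith_geometric_two_thirds: "(\<Sum>j<J. real (Suc j) * (2/3::real) ^ Suc j) \<le> 6"
proof -
  have "(\<Sum>j<J. real (Suc j) * (2/3::real) ^ Suc j) = 6 - (2 * real J + 6) * (2/3) ^ J"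
  proof (induction J)
    case (Suc J)
    show ?case unfolding sum.lessThan_Suc Suc.IH by (simp add: field_simps)
  qed simp
  then show ?thesis by simp
qed

section \<open>Brownian increments on grids and uniform approximation by grid values\<close>

context standard_brownian_motion
begin

text \<open>The right-hand side of \<open>square_le_log_sum_exp\<close> for the \<open>M\<close>
  increments over cells of length 1/M. It replaces their squared maximum because its expectation can
  be computed exactly.\<close>

definition grid_max_bound :: "nat \<Rightarrow> 'b \<Rightarrow> real" where
  "grid_max_bound M \<omega> = 4 / real M * (ln (real M) - 1 +
     (\<Sum>k<M. exp (real M * (B (real (Suc k) / real M) \<omega> - B (real k / real M) \<omega>)\<^sup>2 / 4)) / real M)"

lemma increment_le_grid_max_bound:
  "k < M \<Longrightarrow> (B (real (Suc k) / real M) \<omega> - B (real k / real M) \<omega>)\<^sup>2 \<le> grid_max_bound M \<omega>"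
  unfolding grid_max_bound_def
  by (rule square_le_log_sum_exp[where x = "\<lambda>k. B (real (Suc k) / real M) \<omega> - B (real k / real M) \<omega>"])

lemma grid_max_bound_nonneg: "M > 0 \<Longrightarrow> 0 \<le> grid_max_bound M \<omega>"
  using order_trans[OF zero_le_power2 increment_le_grid_max_bound] by blast

text \<open>Each increment has variance 1/M, so every exponential has mean sqrt 2 and so has their
  average. Bounding sqrt 2 by 3/2 produces the summand 2.\<close>

lemma grid_max_bound_expectation:
  assumes M: "M > 0"
  shows "integrable Q (grid_max_bound M)" "expectation (grid_max_bound M) \<le> (4 * ln (real M) + 2) / real M"
proof -
  let ?X = "\<lambda>k \<omega>. B (real (Suc k) / real M) \<omega> - B (real k / real M) \<omega>"
  have hb: "has_bochner_integral Q (\<lambda>\<omega>. exp (real M * (?X k \<omega>)\<^sup>2 / 4)) (sqrt 2)" for k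
  proof -
    have "distributed Q lborel (?X k) (normal_density 0 (sqrt (real (Suc k) / real M - real k / real M)))"
      using M by (intro BM_normal_increments) (auto simp: divide_strict_right_mono)
    then have D: "distributed Q lborel (?X k) (normal_density 0 (sqrt (1 / real M)))"
      using M by (simp flip: diff_divide_distrib)
    have e: "exp (x\<^sup>2 / (4 * (1 / real M))) = exp (real M * x\<^sup>2 / 4)" for x
      using M by (simp add: field_simps)
    note n = normal_exp_square[of "1 / real M", unfolded e]
    show ?thesis
      using n M distributed_integral[OF D, of "\<lambda>x. exp (real M * x\<^sup>2 / 4)"]
        distributed_integrable[OF D, of "\<lambda>x. exp (real M * x\<^sup>2 / 4)"]
      by (auto simp: has_bochner_integral_iff)
  qed
  have "has_bochner_integral Q (grid_max_bound M)
    (4 / real M * (ln (real M) - 1 + (\<Sum>k<M. sqrt 2) / real M))"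
    unfolding grid_max_bound_def[abs_def]
    by (intro has_bochner_integral_mult_right has_bochner_integral_add has_bochner_integral_divide_zero
        has_bochner_integral_sum hb) (simp add: has_bochner_integral_iff prob_space)
  then have h: "has_bochner_integral Q (grid_max_bound M) (4 / real M * (ln (real M) - 1 + sqrt 2))"
    using M by simp
  have "sqrt 2 \<le> 3/2" by (rule real_le_lsqrt) (auto simp: power2_eq_square)
  then have "4 / real M * (ln (real M) - 1 + sqrt 2) \<le> 4 / real M * (ln (real M) - 1 + 3/2)"
    using M by (intro mult_left_mono) auto
  with h show "integrable Q (grid_max_bound M)"
      "expectation (grid_max_bound M) \<le> (4 * ln (real M) + 2) / real M"
    using M by (auto simp: has_bochner_integral_iff algebra_simps add_divide_distrib diff_divide_distrib)
qed

text \<open>Chaining over the grids of mesh 1/(N 2^j), with \<open>grid_max_bound\<close>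
  controlling each level. A single random \<open>U\<close> dominates all levels, and so serves every
  \<open>s\<close> at once.\<close>

lemma grid_approximation:
  assumes N: "N > 0"
  obtains U where "integrable Q U" "\<And>\<omega>. 0 \<le> U \<omega>"
    "expectation U \<le> (24 * ln (real N) + 64) / real N"
    "AE \<omega> in Q. \<forall>s\<in>{0..1}. \<bar>B s \<omega> - B (real (nat \<lfloor>real N * s\<rfloor>) / real N) \<omega>\<bar> \<le> sqrt (U \<omega>)"
proof -
  define f where "f j \<omega> = (4/3) ^ Suc j * grid_max_bound (N * 2 ^ Suc j) \<omega>" for j \<omega>
  have f: "integrable Q (f j)" "0 \<le> f j \<omega>" for j \<omega>
    unfolding f_def[abs_def] using N grid_max_bound_expectation[of "N * 2 ^ Suc j"]
      grid_max_bound_nonneg[of "N * 2 ^ Suc j" \<omega>]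
    by auto
  have ln2: "ln (2::real) \<le> 7/10" using ln_2_less_1 ln2_le_25_over_36 by simp
  \<comment> \<open>The weight (4/3)^(j+1) meets the denominator 2^(j+1) and leaves the summable
    (2/3)^(j+1). The factor j+1 in the second term comes from the logarithm of 2^(j+1).\<close>
  have Ef: "expectation (f j) \<le> (2/3) ^ Suc j * ((4 * ln (real N) + 2) / real N)
      + real (Suc j) * (2/3) ^ Suc j * (4 * ln 2 / real N)" for j
  proof -
    have "expectation (f j) = (4/3) ^ Suc j * expectation (grid_max_bound (N * 2 ^ Suc j))"
      by (simp add: f_def[abs_def])
    also have "\<dots> \<le> (4/3) ^ Suc j * ((4 * ln (real (N * 2 ^ Suc j)) + 2) / real (N * 2 ^ Suc j))"
      using N by (intro mult_left_mono grid_max_bound_expectation) auto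
    also have "ln (real (N * 2 ^ Suc j)) = ln (real N) + real (Suc j) * ln 2"
      using N by (simp add: ln_mult ln_realpow del: power_Suc)
    also have "(4/3) ^ Suc j * ((4 * (ln (real N) + real (Suc j) * ln 2) + 2) / real (N * 2 ^ Suc j))
       = ((4/3) ^ Suc j / 2 ^ Suc j) * ((4 * (ln (real N) + real (Suc j) * ln 2) + 2) / real N)"
      by (simp add: ac_simps del: power_Suc)
    also have "(4/3) ^ Suc j / 2 ^ Suc j = (2/3::real) ^ Suc j"
      by (simp flip: power_divide del: power_Suc)
    finally show ?thesis by (simp add: add_divide_distrib algebra_simps del: power_Suc)
  qed
  have "(\<Sum>j<J. expectation (f j)) \<le> (24 * ln (real N) + 64) / (3 * real N)" for J
  proof -
    have "(\<Sum>j<J. expectation (f j)) \<le> (\<Sum>j<J. (2/3) ^ Suc j * ((4 * ln (real N) + 2) / real N)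
        + real (Suc j) * (2/3) ^ Suc j * (4 * ln 2 / real N))"
      by (intro sum_mono Ef)
    also have "\<dots> = (\<Sum>j<J. (2/3) ^ Suc j) * ((4 * ln (real N) + 2) / real N)
       + (\<Sum>j<J. real (Suc j) * (2/3) ^ Suc j) * (4 * ln 2 / real N)"
      by (simp only: sum.distrib sum_distrib_right)
    also have "\<dots> \<le> 2 * ((4 * ln (real N) + 2) / real N) + 6 * (4 * ln 2 / real N)"
      using N by (intro add_mono mult_right_mono sum_geometric_two_thirds sum_arith_geometric_two_thirds)
        (auto intro!: divide_nonneg_pos add_nonneg_nonneg)
    \<comment> \<open>Times 3N this reads 24 ln N + 12 + 72 ln 2, and 72 * 7/10 = 50.4 leaves room
      below 64.\<close>
    also have "\<dots> \<le> (24 * ln (real N) + 64) / (3 * real N)"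
      using N ln2 by (simp add: field_simps)
    finally show ?thesis .
  qed
  from integrable_dominating_partial_sums[of Q f, OF f this]
  obtain U where U: "integrable Q U" "\<And>\<omega>. 0 \<le> U \<omega>"
      "expectation U \<le> (24 * ln (real N) + 64) / (3 * real N)"
      "AE \<omega> in Q. \<forall>J. (\<Sum>j<J. f j \<omega>) \<le> U \<omega>"
    by blast
  show thesis
  \<comment> \<open>The factor 3 is the sum of the Cauchy-Schwarz weights in
    \<open>chaining\<close>.\<close>
  proof (rule that[of "\<lambda>\<omega>. 3 * U \<omega>"])
    show "expectation (\<lambda>\<omega>. 3 * U \<omega>) \<le> (24 * ln (real N) + 64) / real N"
      using U(3) N by (simp add: field_simps)
    show "AE \<omega> in Q. \<forall>s\<in>{0..1}. \<bar>B s \<omega> - B (real (nat \<lfloor>real N * s\<rfloor>) / real N) \<omega>\<bar> \<le> sqrt (3 * U \<omega>)"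
      using U(4) AE_space
    proof eventually_elim
      case (elim \<omega>)
      show ?case
      proof
        fix s :: real assume "s \<in> {0..1}"
        then show "\<bar>B s \<omega> - B (real (nat \<lfloor>real N * s\<rfloor>) / real N) \<omega>\<bar> \<le> sqrt (3 * U \<omega>)"
          using elim
          by (intro chaining[where H = "\<lambda>j. grid_max_bound (N * 2 ^ Suc j) \<omega>"] N
              increment_le_grid_max_bound continuous_on_subset[OF BM_continuous])
            (auto simp: f_def)
      qed
    qed
  qed (use U in auto)
qed

end

section \<open>Test functions of class \<open>M\<^sup>2\<close>\<close>

lemma norm_path_leI: "(\<And>t. t \<in> {0..1} \<Longrightarrow> \<bar>sk_path w t\<bar> \<le> c) \<Longrightarrow> norm w \<le> c"
  unfolding norm_skorokhod_def by (rule cSUP_least) auto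

lemma path_sum: "sk_path (\<Sum>k\<in>K. x k *\<^sub>R h k) t = (\<Sum>k\<in>K. x k * sk_path (h k) t)"
  by (induction K rule: infinite_finite_induct)
    (auto simp: zero_skorokhod.rep_eq plus_skorokhod.rep_eq scaleR_skorokhod.rep_eq)

lemma skor_cong: "(\<And>t. t \<in> {0..1} \<Longrightarrow> v t = w t) \<Longrightarrow> skor v = skor w"
  unfolding skor_def by (rule arg_cong[where f = Abs_skorokhod]) auto

text \<open>Rescaling to the unit sphere by homogeneity of degree \<open>d\<close>. Degree 1 serves
  the first derivative, degree 2 the diagonal of the second, which is all that expansions along a
  line involve.\<close>

lemma abs_le_form_norm:
  assumes bdd: "bdd_above ((\<lambda>h. \<bar>F h\<bar>) ` {h. norm h = 1})"
    and hom: "\<And>c h. F (c *\<^sub>R h) = c ^ d * F h" and d: "d > 0"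
  shows "\<bar>F h\<bar> \<le> form_norm F * norm h ^ d"
proof (cases "h = 0")
  case True
  then show ?thesis using hom[of 0 h] d by (simp add: power_0_left)
next
  case False
  have "\<bar>F (sgn h)\<bar> \<le> form_norm F"
    unfolding form_norm_def using False by (intro cSUP_upper bdd) (simp add: norm_sgn)
  then have "norm h ^ d * \<bar>F (sgn h)\<bar> \<le> norm h ^ d * form_norm F"
    by (intro mult_left_mono) auto
  moreover have "\<bar>F h\<bar> = norm h ^ d * \<bar>F (sgn h)\<bar>"
  proof -
    have e: "norm h *\<^sub>R sgn h = h" using False by (simp add: sgn_div_norm)
    have "F h = F (norm h *\<^sub>R sgn h)" unfolding e ..
    also have "\<dots> = norm h ^ d * F (sgn h)" by (rule hom)
    finally show ?thesis by (simp only: abs_mult power_abs abs_norm_cancel)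
  qed
  ultimately show ?thesis by (simp only: mult.commute)
qed

context
  fixes g :: "skorokhod \<Rightarrow> real"
  assumes g: "g \<in> M2_class"
begin

lemma M2_continuous: "continuous_on UNIV g"
  and M2_derivative: "(g has_derivative blinfun_apply (frechet g w)) (at w)"
  and M2_derivative2: "(frechet g has_derivative blinfun_apply (D2 g w)) (at w)"
  using g by (auto simp: M2_class_def M_class_def intro!: has_derivative_frechet)

lemma M2_line_derivative:
  "((\<lambda>x. g (w + x *\<^sub>R h)) has_real_derivative frechet g (w + x *\<^sub>R h) h) (at x)"
proof -
  have "((\<lambda>x. g (w + x *\<^sub>R h)) has_derivative (\<lambda>y. frechet g (w + x *\<^sub>R h) (y *\<^sub>R h))) (at x)"
    by (rule has_derivative_compose[OF _ M2_derivative]) (auto intro!: derivative_eq_intros)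
  then show ?thesis
    by (simp add: has_field_derivative_def blinfun.scaleR_right mult_commute_abs)
qed

lemma M2_line_derivative2:
  "((\<lambda>x. frechet g (w + x *\<^sub>R h) h) has_real_derivative D2 g (w + x *\<^sub>R h) h h) (at x)"
proof -
  have "((\<lambda>x. frechet g (w + x *\<^sub>R h)) has_derivative (\<lambda>y. D2 g (w + x *\<^sub>R h) (y *\<^sub>R h))) (at x)"
    by (rule has_derivative_compose[OF _ M2_derivative2]) (auto intro!: derivative_eq_intros)
  then have "((\<lambda>x. frechet g (w + x *\<^sub>R h) h) has_derivative (\<lambda>y. D2 g (w + x *\<^sub>R h) (y *\<^sub>R h) h)) (at x)"
    by (auto intro!: derivative_eq_intros)
  then show ?thesis
    by (simp add: has_field_derivative_def blinfun.scaleR_right blinfun.scaleR_left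
        mult_commute_abs)
qed

end

section \<open>Estimates extracted from the norm\<close>

context
  fixes g :: "skorokhod \<Rightarrow> real" and K :: real
  assumes g: "g \<in> M2_class" and K_def: "K = enn2real (M2_norm g)"
begin

lemma M2_norm_eq: "M2_norm g = ennreal K"
proof -
  have "M2_norm g < top" using g unfolding M2_class_def by (metis (mono_tags, lifting) infinity_ennreal_def mem_Collect_eq)
  then show ?thesis unfolding K_def by (rule ennreal_enn2real[symmetric])
qed

lemma M2_norm_nonneg: "0 \<le> K"
  by (simp add: K_def)

text \<open>Each summand of \<open>M2_norm\<close> lies below the whole, so the single constant
  \<open>K\<close> serves here and in the Lipschitz estimate for the second derivative.\<close>

lemma M2_first_derivative_bound: "\<bar>frechet g w h\<bar> \<le> K * (1 + norm w) * norm h"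
proof -
  have "ennreal (form_norm (\<lambda>u. frechet g w u) / (1 + norm w)) \<le>
      (SUP w. ennreal (form_norm (\<lambda>u. frechet g w u) / (1 + norm w)))"
    by (rule SUP_upper) simp
  also have "\<dots> \<le> M2_norm g"
    unfolding M2_norm_def
    by (intro add_increasing2[OF zero_le add_increasing2[OF zero_le add_increasing[OF zero_le order_refl]]])
  finally have "form_norm (\<lambda>u. frechet g w u) / (1 + norm w) \<le> K"
    by (simp add: M2_norm_eq M2_norm_nonneg)
  then have le: "form_norm (\<lambda>u. frechet g w u) \<le> K * (1 + norm w)"
    by (subst (asm) pos_divide_le_eq) (simp_all add: add_pos_nonneg)
  have hom: "frechet g w (c *\<^sub>R u) = c ^ 1 * frechet g w u" for c u
    by (simp add: blinfun.scaleR_right)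
  have b: "\<bar>frechet g w h\<bar> \<le> form_norm (\<lambda>u. frechet g w u) * norm h ^ 1"
    by (rule abs_le_form_norm[where F = "blinfun_apply (frechet g w)" and d = 1, OF bdd_above_linear_form hom]) simp
  show ?thesis using b mult_right_mono[OF le, of "norm h"] by simp
qed

lemma M2_second_derivative_lipschitz:
  "\<bar>(D2 g (w + h) - D2 g w) u u\<bar> \<le> K * norm h * (norm u)\<^sup>2"
proof (cases "h = 0")
  case False
  let ?F = "\<lambda>u. (D2 g (w + h) - D2 g w) u u"
  have "ennreal (form_norm ?F / norm h) \<le>
      (SUP h\<in>{h. h \<noteq> 0}. ennreal (form_norm (\<lambda>u. (D2 g (w + h) - D2 g w) u u) / norm h))"
    by (rule SUP_upper) (simp add: False)
  also have "\<dots> \<le> (SUP w. SUP h\<in>{h. h \<noteq> 0}. ennreal (form_norm (\<lambda>u. (D2 g (w + h) - D2 g w) u u) / norm h))"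
    by (rule SUP_upper) simp
  also have "\<dots> \<le> M2_norm g"
    unfolding M2_norm_def by (rule add_increasing[OF zero_le order_refl])
  finally have "form_norm ?F / norm h \<le> K"
    by (simp add: M2_norm_eq M2_norm_nonneg)
  then have le: "form_norm ?F \<le> K * norm h"
    using False by (simp add: pos_divide_le_eq)
  have hom: "?F (c *\<^sub>R u) = c ^ 2 * ?F u" for c u
    by (simp add: blinfun.scaleR_right blinfun.scaleR_left power2_eq_square)
  have b: "\<bar>?F u\<bar> \<le> form_norm ?F * norm u ^ 2"
    by (rule abs_le_form_norm[where F = ?F and d = 2, OF bdd_above_bilinear_form hom]) simp
  show ?thesis using order_trans[OF b mult_right_mono[OF le, of "(norm u)\<^sup>2"]] by simp
qed simp

text \<open>On the segment from \<open>w\<close> to \<open>v\<close> the norm is at most the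
  interpolated norm of the endpoints. Integrating the linear growth of the derivative along it gives
  the average of the two norms.\<close>

lemma M2_difference_bound:
  "\<bar>g v - g w\<bar> \<le> K * (1 + (norm v + norm w) / 2) * norm (v - w)"
proof -
  let ?h = "v - w"
  \<comment> \<open>The antiderivative of the bound on the derivative along the segment.\<close>
  let ?\<phi> = "\<lambda>x::real. K * norm ?h * (x + norm w * (x - x\<^sup>2 / 2) + norm v * x\<^sup>2 / 2)"
  have "norm (g (w + 1 *\<^sub>R ?h) - g (w + 0 *\<^sub>R ?h)) \<le> ?\<phi> 1 - ?\<phi> 0"
  proof (rule differentiable_bound_general[where f' = "\<lambda>x. frechet g (w + x *\<^sub>R ?h) ?h"
      and \<phi>' = "\<lambda>x. K * norm ?h * (1 + norm w * (1 - x) + norm v * x)"])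
    show "continuous_on {0..1} (\<lambda>x. g (w + x *\<^sub>R ?h))"
      by (intro continuous_on_compose2[OF M2_continuous[OF g]] continuous_intros) auto
    fix x :: real assume x: "0 < x" "x < 1"
    show "((\<lambda>x. g (w + x *\<^sub>R ?h)) has_vector_derivative frechet g (w + x *\<^sub>R ?h) ?h) (at x)"
      using M2_line_derivative[OF g] by (simp add: has_real_derivative_iff_has_vector_derivative)
    show "(?\<phi> has_vector_derivative K * norm ?h * (1 + norm w * (1 - x) + norm v * x)) (at x)"
      unfolding has_real_derivative_iff_has_vector_derivative[symmetric]
      by (auto intro!: derivative_eq_intros)
    have "w + x *\<^sub>R ?h = (1 - x) *\<^sub>R w + x *\<^sub>R v" by (simp add: algebra_simps)
    also have "norm \<dots> \<le> norm w * (1 - x) + norm v * x"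
      using x by (intro order_trans[OF norm_triangle_ineq]) (simp add: mult.commute)
    finally have "K * (1 + norm (w + x *\<^sub>R ?h)) * norm ?h \<le> K * (1 + norm w * (1 - x) + norm v * x) * norm ?h"
      using M2_norm_nonneg by (intro mult_right_mono mult_left_mono) auto
    then show "norm (frechet g (w + x *\<^sub>R ?h) ?h) \<le> K * norm ?h * (1 + norm w * (1 - x) + norm v * x)"
      using M2_first_derivative_bound[of "w + x *\<^sub>R ?h" ?h] by (simp add: ac_simps)
  qed (auto intro!: continuous_intros)
  then show ?thesis by (simp add: field_simps)
qed

text \<open>The linear growth of the derivative improves the cubic growth built into
  \<open>M_class\<close> to a quadratic one, for which second moments are enough.\<close>

lemma M2_quadratic_growth: "\<bar>g w\<bar> \<le> (\<bar>g 0\<bar> + K) * (1 + (norm w)\<^sup>2)"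
proof -
  have "\<bar>g w - g 0\<bar> \<le> K * (norm w + (norm w)\<^sup>2 / 2)"
    using M2_difference_bound[of w 0] by (simp add: field_simps power2_eq_square)
  then have "\<bar>g w\<bar> \<le> \<bar>g 0\<bar> + K * (norm w + (norm w)\<^sup>2 / 2)" by linarith
  also have "norm w + (norm w)\<^sup>2 / 2 \<le> 1 + (norm w)\<^sup>2"
    using zero_le_power2[of "norm w - 1"] by (simp add: power2_diff)
  also have "\<bar>g 0\<bar> \<le> \<bar>g 0\<bar> * (1 + (norm w)\<^sup>2)" by (simp add: algebra_simps)
  finally show ?thesis using M2_norm_nonneg by (simp add: distrib_right mult_left_mono)
qed

text \<open>Second-order Taylor expansion along the line with Lagrange remainder. Moving the second
  derivative from the intermediate point back to \<open>w\<close> costs the Lipschitz bound, so the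
  coefficients do not depend on \<open>x\<close>.\<close>

lemma M2_quadratic_approximation:
  "\<exists>a b. \<forall>x. \<bar>g (w + x *\<^sub>R h) - g w - a * x - b * x\<^sup>2\<bar> \<le> K * norm h ^ 3 / 2 * \<bar>x\<bar> ^ 3"
proof (intro exI allI)
  fix x :: real
  let ?D = "\<lambda>m x. if m = 0 then g (w + x *\<^sub>R h) else if m = Suc 0 then frechet g (w + x *\<^sub>R h) h
      else D2 g (w + x *\<^sub>R h) h h"
  show "\<bar>g (w + x *\<^sub>R h) - g w - frechet g w h * x - D2 g w h h / 2 * x\<^sup>2\<bar>
      \<le> K * norm h ^ 3 / 2 * \<bar>x\<bar> ^ 3"
  proof (cases "x = 0")
    case False
    have "\<exists>t. (if x < 0 then x < t \<and> t < 0 else 0 < t \<and> t < x) \<and>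
       g (w + x *\<^sub>R h) = (\<Sum>m<2. ?D m 0 / fact m * (x - 0) ^ m) + ?D 2 t / fact 2 * (x - 0) ^ 2"
    \<comment> \<open>The symmetric interval treats both signs of \<open>x\<close> at once.\<close>
    proof (rule Taylor[where a = "- \<bar>x\<bar>" and b = "\<bar>x\<bar>"])
      show "\<forall>m t. m < 2 \<and> - \<bar>x\<bar> \<le> t \<and> t \<le> \<bar>x\<bar> \<longrightarrow> (?D m has_real_derivative ?D (Suc m) t) (at t)"
        using M2_line_derivative[OF g] M2_line_derivative2[OF g] by (auto simp: less_2_cases_iff)
    qed (use False in auto)
    then obtain t where t: "if x < 0 then x < t \<and> t < 0 else 0 < t \<and> t < x"
      and eq: "g (w + x *\<^sub>R h) = (\<Sum>m<2. ?D m 0 / fact m * (x - 0) ^ m) + ?D 2 t / fact 2 * (x - 0) ^ 2"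
      by blast
    from t have t: "\<bar>t\<bar> \<le> \<bar>x\<bar>" by (auto split: if_splits)
    from eq have eq: "g (w + x *\<^sub>R h) = g w + frechet g w h * x + D2 g (w + t *\<^sub>R h) h h / 2 * x\<^sup>2"
      by (simp add: numeral_2_eq_2)
    have "\<bar>g (w + x *\<^sub>R h) - g w - frechet g w h * x - D2 g w h h / 2 * x\<^sup>2\<bar>
        = \<bar>(D2 g (w + t *\<^sub>R h) - D2 g w) h h\<bar> / 2 * x\<^sup>2"
    proof -
      have "g (w + x *\<^sub>R h) - g w - frechet g w h * x - D2 g w h h / 2 * x\<^sup>2
          = (D2 g (w + t *\<^sub>R h) - D2 g w) h h / 2 * x\<^sup>2"
        unfolding eq by (simp add: blinfun.diff_left field_simps)
      then show ?thesis by (simp only: abs_mult abs_divide abs_power2 abs_numeral)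
    qed
    also have "\<dots> \<le> K * norm (t *\<^sub>R h) * (norm h)\<^sup>2 / 2 * x\<^sup>2"
      by (intro mult_right_mono divide_right_mono M2_second_derivative_lipschitz) auto
    also have "\<dots> \<le> K * (\<bar>x\<bar> * norm h) * (norm h)\<^sup>2 / 2 * \<bar>x\<bar>\<^sup>2"
      using t M2_norm_nonneg by (auto intro!: mult_right_mono divide_right_mono mult_left_mono)
    finally show ?thesis by (simp add: power3_eq_cube power2_eq_square ac_simps)
  qed simp
qed

end

section \<open>Edges and the associated random variables\<close>

text \<open>Events chosen for the indices in \<open>I\<close> are moved to their images by
  \<open>inv_into\<close>, where independence is known. It carries the independence of numbered
  increments over to edges.\<close>

lemma (in prob_space) indep_vars_reindex:
  assumes X: "indep_vars M' X (f ` I)" and f: "inj_on f I"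
  shows "indep_vars (\<lambda>i. M' (f i)) (\<lambda>i. X (f i)) I"
  unfolding indep_vars_def
proof (intro conjI)
  let ?F = "\<lambda>i. sigma_sets (space M) {X i -` A \<inter> space M |A. A \<in> sets (M' i)}"
  show "\<forall>i\<in>I. random_variable (M' (f i)) (X (f i))"
    using X by (auto simp: indep_vars_def)
  have F: "indep_sets ?F (f ` I)" using X by (simp add: indep_vars_def)
  show "indep_sets (\<lambda>i. ?F (f i)) I"
  proof (rule indep_setsI)
    show "?F (f i) \<subseteq> events" if "i \<in> I" for i using F that by (auto simp: indep_sets_def)
  next
    fix A J assume J: "J \<noteq> {}" "J \<subseteq> I" "finite J" and A: "\<forall>j\<in>J. A j \<in> ?F (f j)"
    have inj: "inj_on f J" using f J(2) by (rule inj_on_subset)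
    let ?A = "\<lambda>k. A (inv_into J f k)"
    have "prob (\<Inter>k\<in>f ` J. ?A k) = (\<Prod>k\<in>f ` J. prob (?A k))"
      using J A inj by (intro indep_setsD[OF F]) (auto simp: inv_into_f_f)
    then show "prob (\<Inter>j\<in>J. A j) = (\<Prod>j\<in>J. prob (A j))"
      using inj by (simp add: prod.reindex inv_into_f_f cong: prod.cong INF_cong)
  qed
qed

lemma edges_Suc: "edges (Suc m) = edges m \<union> (\<lambda>i. (i, Suc m)) ` {1..m}"
  by (auto simp: edges_def)

lemma edges_mono: "m \<le> n \<Longrightarrow> edges m \<subseteq> edges n"
  by (auto simp: edges_def)

lemma finite_edges: "finite (edges m)"
  by (rule finite_subset[of _ "{..m} \<times> {..m}"]) (auto simp: edges_def)

text \<open>Enumerates the edges so that, for every \<open>m\<close>, those among the first \<open>m\<close> vertices come first.\<close>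

definition edge_index :: "nat \<times> nat \<Rightarrow> nat" where
  "edge_index e = ((snd e - 1) choose 2) + (fst e - 1)"

text \<open>Vertex \<open>Suc m\<close> adds the \<open>m\<close> edges to smaller vertices, and
  these fill exactly the block of \<open>m\<close> indices following
  \<open>m choose 2\<close>.\<close>

lemma bij_betw_edge_index: "bij_betw edge_index (edges m) {..<m choose 2}"
proof (induction m)
  case 0
  have "edges 0 = {}" by (auto simp: edges_def)
  then show ?case by (simp add: bij_betw_def numeral_2_eq_2)
next
  case (Suc m)
  have c: "Suc m choose 2 = (m choose 2) + m" by (simp add: numeral_2_eq_2)
  have "bij_betw edge_index (edges m \<union> (\<lambda>i. (i, Suc m)) ` {1..m})
     ({..<m choose 2} \<union> {m choose 2..<(m choose 2) + m})"
  proof (rule bij_betw_combine[OF Suc.IH])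
    have "(\<lambda>i. (m choose 2) + (i - 1)) ` {1..m} = {m choose 2..<(m choose 2) + m}"
    proof (intro equalityI subsetI)
      fix k assume "k \<in> {m choose 2..<(m choose 2) + m}"
      then have "k = (m choose 2) + (Suc (k - (m choose 2)) - 1)" "Suc (k - (m choose 2)) \<in> {1..m}"
        by auto
      then show "k \<in> (\<lambda>i. (m choose 2) + (i - 1)) ` {1..m}" by (rule image_eqI)
    qed auto
    then show "bij_betw edge_index ((\<lambda>i. (i, Suc m)) ` {1..m}) {m choose 2..<(m choose 2) + m}"
      by (auto simp: bij_betw_def inj_on_def edge_index_def image_image)
  qed auto
  then show ?case by (simp add: edges_Suc c ivl_disj_un)
qed

lemma card_edges: "card (edges m) = m choose 2"
  using bij_betw_same_card[OF bij_betw_edge_index] by simp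

lemma real_choose_two: "real (m choose 2) = real m * (real m - 1) / 2"
  by (induction m) (auto simp: numeral_2_eq_2 field_simps)

lemma sum_edges_telescope:
  fixes f :: "nat \<Rightarrow> real"
  shows "(\<Sum>e\<in>edges m. f (Suc (edge_index e)) - f (edge_index e)) = f (m choose 2) - f 0"
  using sum.reindex_bij_betw[OF bij_betw_edge_index, of "\<lambda>k. f (Suc k) - f k" m]
  by (simp add: sum_lessThan_telescope)

section \<open>Moments of Bernoulli and Gaussian variables\<close>

lemma bernoulli_rv_expectation:
  assumes P: "prob_space P" and I: "bernoulli_rv P p X" and p: "0 < p" "p < 1"
    and f: "f \<in> borel_measurable borel"
  shows "integrable P (\<lambda>\<omega>. f (X \<omega>))" "(\<integral>\<omega>. f (X \<omega>) \<partial>P) = p * f 1 + (1 - p) * (f 0 :: real)"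
proof -
  have X: "X \<in> borel_measurable P"
    and D: "distr P borel X = distr (measure_pmf (bernoulli_pmf p)) borel of_bool"
    using I by (auto simp: bernoulli_rv_def)
  have "integrable (measure_pmf (bernoulli_pmf p)) (\<lambda>b. f (of_bool b))"
    by (rule integrable_measure_pmf_finite) (rule finite_subset[OF subset_UNIV], simp)
  then have "integrable (distr (measure_pmf (bernoulli_pmf p)) borel of_bool) f"
    using f by (subst integrable_distr_eq) auto
  then show "integrable P (\<lambda>\<omega>. f (X \<omega>))"
    using X f unfolding D[symmetric] by (subst (asm) integrable_distr_eq) auto
  have "(\<integral>\<omega>. f (X \<omega>) \<partial>P) = (\<integral>x. f x \<partial>distr P borel X)"
    using X f by (simp add: integral_distr)
  also have "\<dots> = (\<integral>b. f (of_bool b) \<partial>measure_pmf (bernoulli_pmf p))"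
    unfolding D using f by (subst integral_distr) auto
  also have "\<dots> = p * f 1 + (1 - p) * f 0" using p by simp
  finally show "(\<integral>\<omega>. f (X \<omega>) \<partial>P) = p * f 1 + (1 - p) * f 0" .
qed

lemma (in prob_space) normal_moments:
  fixes X :: "'a \<Rightarrow> real"
  assumes D: "distributed M lborel X (normal_density 0 s)" and s: "s > 0"
  shows "expectation X = 0" "expectation (\<lambda>\<omega>. (X \<omega>)\<^sup>2) = s\<^sup>2"
    "integrable M (\<lambda>\<omega>. \<bar>X \<omega>\<bar> ^ 3)" "expectation (\<lambda>\<omega>. \<bar>X \<omega>\<bar> ^ 3) \<le> 2 * s ^ 3"
proof -
  show "expectation X = 0"
    using distributed_integral[OF D, of "\<lambda>x. x"] integral_normal_moment_nz_1[OF s, of 0] by simp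
  show "expectation (\<lambda>\<omega>. (X \<omega>)\<^sup>2) = s\<^sup>2"
    using distributed_integral[OF D, of "\<lambda>x. x\<^sup>2"] integral_normal_moment_even[OF s, of 0 1] s
    by simp
  have h: "has_bochner_integral lborel (\<lambda>x. normal_density 0 s x * \<bar>x\<bar> ^ 3) (2 * s ^ 3 * sqrt (2 / pi))"
    using normal_moment_abs_odd[OF s, of 0 1] by (simp add: numeral_3_eq_3)
  show "integrable M (\<lambda>\<omega>. \<bar>X \<omega>\<bar> ^ 3)"
    using distributed_integrable[OF D, of "\<lambda>x. \<bar>x\<bar> ^ 3"] h by (simp add: has_bochner_integral_iff)
  have "expectation (\<lambda>\<omega>. \<bar>X \<omega>\<bar> ^ 3) = 2 * s ^ 3 * sqrt (2 / pi)"
    using distributed_integral[OF D, of "\<lambda>x. \<bar>x\<bar> ^ 3"] h by (simp add: has_bochner_integral_iff)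
  also have "sqrt (2 / pi) \<le> 1" using pi_gt3 by (intro real_le_lsqrt) auto
  finally show "expectation (\<lambda>\<omega>. \<bar>X \<omega>\<bar> ^ 3) \<le> 2 * s ^ 3"
    using s by (simp add: mult_left_le)
qed

section \<open>The path carried by a single edge\<close>

definition edge_vec :: "nat \<Rightarrow> nat \<times> nat \<Rightarrow> skorokhod" where
  "edge_vec n e = skor (\<lambda>t. (real_of_int \<lfloor>real n * t\<rfloor> - 2) / (real n)\<^sup>2 *
     of_bool (e \<in> edges (nat \<lfloor>real n * t\<rfloor>)))"

lemma path_edge_vec:
  assumes "n > 0" "t \<in> {0..1}"
  shows "sk_path (edge_vec n e) t = (real_of_int \<lfloor>real n * t\<rfloor> - 2) / (real n)\<^sup>2 *
     of_bool (e \<in> edges (nat \<lfloor>real n * t\<rfloor>))"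
proof -
  have "cadlag (\<lambda>t. (real_of_int \<lfloor>real n * t\<rfloor> - 2) / (real n)\<^sup>2 * of_bool (e \<in> edges (nat \<lfloor>real n * t\<rfloor>)))"
    using assms by (intro cadlag_floor[where F = "\<lambda>k. (real_of_int k - 2) / (real n)\<^sup>2 * of_bool (e \<in> edges (nat k))"]) auto
  then show ?thesis using assms(2) unfolding edge_vec_def by (simp add: path_skor)
qed

lemma grid_floor:
  assumes "t \<in> {0..1}"
  obtains m where "nat \<lfloor>real n * t\<rfloor> = m" "real_of_int \<lfloor>real n * t\<rfloor> = real m"
    "real m \<le> real n * t" "real n * t < real m + 1" "m \<le> n"
proof -
  define m where "m = nat \<lfloor>real n * t\<rfloor>"
  have f: "0 \<le> \<lfloor>real n * t\<rfloor>" using assms by auto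
  then have r: "real_of_int \<lfloor>real n * t\<rfloor> = real m" by (simp add: m_def of_nat_nat)
  have "real n * t \<le> real n * 1" using assms by (intro mult_left_mono) auto
  moreover have b: "real m \<le> real n * t" "real n * t < real m + 1"
    unfolding r[symmetric] by linarith+
  ultimately have "m \<le> n" by linarith
  then show thesis using r b that m_def by blast
qed

text \<open>The factor m - 2 is negative only for m < 2, when no edge is present. Otherwise it lies
  between 0 and \<open>n\<close>.\<close>

lemma norm_edge_vec:
  assumes n: "n > 0"
  shows "norm (edge_vec n e) \<le> 1 / real n"
proof (rule norm_path_leI)
  fix t :: real assume t: "t \<in> {0..1}"
  obtain m where m: "nat \<lfloor>real n * t\<rfloor> = m" "real_of_int \<lfloor>real n * t\<rfloor> = real m" "m \<le> n"
    using grid_floor[OF t] by metis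
  show "\<bar>sk_path (edge_vec n e) t\<bar> \<le> 1 / real n"
  proof (cases "e \<in> edges m")
    case True
    then have "2 \<le> m" by (auto simp: edges_def)
    then have "\<bar>(real m - 2) / (real n)\<^sup>2\<bar> \<le> real n / (real n)\<^sup>2"
      using m(3) by (simp add: divide_right_mono)
    also have "\<dots> = 1 / real n" using n by (simp add: power2_eq_square)
    finally show ?thesis using True by (simp add: path_edge_vec[OF n t] m)
  qed (simp add: path_edge_vec[OF n t] m)
qed

text \<open>The time dependence of the index set moves into the fixed paths \<open>edge_vec\<close>.
  The coefficients are arbitrary, so that the centred indicators and their Gaussian substitutes are
  covered alike.\<close>

lemma skor_edge_sum:
  assumes n: "n > 0"
  shows "skor (\<lambda>t. (real_of_int \<lfloor>real n * t\<rfloor> - 2) / (real n)\<^sup>2 * (\<Sum>e\<in>edges (nat \<lfloor>real n * t\<rfloor>). x e))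
    = (\<Sum>e\<in>edges n. x e *\<^sub>R edge_vec n e)"
proof (rule path_eqI)
  fix t :: real assume t: "t \<in> {0..1}"
  have "cadlag (\<lambda>t. (real_of_int \<lfloor>real n * t\<rfloor> - 2) / (real n)\<^sup>2 * (\<Sum>e\<in>edges (nat \<lfloor>real n * t\<rfloor>). x e))"
    using n by (intro cadlag_floor[where F = "\<lambda>k. (real_of_int k - 2) / (real n)\<^sup>2 * (\<Sum>e\<in>edges (nat k). x e)"]) auto
  then have "sk_path (skor (\<lambda>t. (real_of_int \<lfloor>real n * t\<rfloor> - 2) / (real n)\<^sup>2 * (\<Sum>e\<in>edges (nat \<lfloor>real n * t\<rfloor>). x e))) t
     = (real_of_int \<lfloor>real n * t\<rfloor> - 2) / (real n)\<^sup>2 * (\<Sum>e\<in>edges (nat \<lfloor>real n * t\<rfloor>). x e)"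
    using t by (simp add: path_skor)
  also obtain m where m: "nat \<lfloor>real n * t\<rfloor> = m" "m \<le> n" using grid_floor[OF t] by metis
  have "(\<Sum>e\<in>edges m. x e) = (\<Sum>e\<in>edges n. x e * of_bool (e \<in> edges m))"
    using edges_mono[OF m(2)] finite_edges by (intro sum.mono_neutral_cong_left) auto
  then have "(real_of_int \<lfloor>real n * t\<rfloor> - 2) / (real n)\<^sup>2 * (\<Sum>e\<in>edges (nat \<lfloor>real n * t\<rfloor>). x e)
     = sk_path (\<Sum>e\<in>edges n. x e *\<^sub>R edge_vec n e) t"
    unfolding path_sum path_edge_vec[OF n t] m(1)
    by (simp only: sum_distrib_left mult.left_commute)
  finally show "sk_path (skor (\<lambda>t. (real_of_int \<lfloor>real n * t\<rfloor> - 2) / (real n)\<^sup>2 * (\<Sum>e\<in>edges (nat \<lfloor>real n * t\<rfloor>). x e))) t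
     = sk_path (\<Sum>e\<in>edges n. x e *\<^sub>R edge_vec n e) t" .
qed

lemma skor_Y_proc:
  assumes n: "n > 0" and P: "prob_space P" and p: "0 < p" "p < 1"
    and I: "\<And>e. e \<in> edges n \<Longrightarrow> bernoulli_rv P p (I e)"
  shows "skor (Y_proc P n I \<omega>) = (\<Sum>e\<in>edges n. (I e \<omega> - p) *\<^sub>R edge_vec n e)"
proof -
  have "Y_proc P n I \<omega> t = (real_of_int \<lfloor>real n * t\<rfloor> - 2) / (real n)\<^sup>2 *
      (\<Sum>e\<in>edges (nat \<lfloor>real n * t\<rfloor>). I e \<omega> - p)" if t: "t \<in> {0..1}" for t
  proof -
    obtain m where m: "nat \<lfloor>real n * t\<rfloor> = m" "m \<le> n" using grid_floor[OF t] by metis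
    have I': "integrable P (I e)" "(\<integral>\<omega>. I e \<omega> \<partial>P) = p" if "e \<in> edges m" for e
      using bernoulli_rv_expectation[OF P I p, of e "\<lambda>x. x"] edges_mono[OF m(2)] that by auto
    show ?thesis
      by (simp add: Y_proc_def T_proc_def m I' sum_subtractf right_diff_distrib)
  qed
  then show ?thesis
    unfolding skor_edge_sum[OF n, symmetric] by (rule skor_cong)
qed

section \<open>Comparison of the processes\<close>

text \<open>Uniform continuity makes the path a norm limit of step paths built from its values at
  m/k. These are finite linear combinations of fixed paths, where measurability is known.\<close>

lemma borel_measurable_continuous_functional:
  fixes X :: "real \<Rightarrow> 'a \<Rightarrow> real" and g :: "skorokhod \<Rightarrow> real"
  assumes g: "continuous_on UNIV g"
    and X: "\<And>t. t \<in> {0..1} \<Longrightarrow> X t \<in> borel_measurable M"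
    and cont: "\<And>\<omega>. \<omega> \<in> space M \<Longrightarrow> continuous_on {0..1} (\<lambda>t. X t \<omega>)"
  shows "(\<lambda>\<omega>. g (skor (\<lambda>t. X t \<omega>))) \<in> borel_measurable M"
proof (rule borel_measurable_LIMSEQ_real)
  define v where "v k m = skor (\<lambda>t. of_bool (nat \<lfloor>real k * t\<rfloor> = m))" for k m :: nat
  \<comment> \<open>The index m = k is included because the floor equals k at t = 1.\<close>
  define W where "W k \<omega> = (\<Sum>m\<le>k. X (real m / real k) \<omega> *\<^sub>R v k m)" for k \<omega>
  have path_W: "sk_path (W k \<omega>) t = X (real (nat \<lfloor>real k * t\<rfloor>) / real k) \<omega>"
    if t: "t \<in> {0..1}" and k: "k > 0" for t k \<omega>
  proof -
    have "cadlag (\<lambda>t. of_bool (nat \<lfloor>real k * t\<rfloor> = m))" for m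
      using k by (intro cadlag_floor[where F = "\<lambda>i. of_bool (nat i = m)"]) auto
    then have v: "sk_path (v k m) t = of_bool (nat \<lfloor>real k * t\<rfloor> = m)" for m
      using t by (simp add: v_def path_skor)
    obtain j where j: "nat \<lfloor>real k * t\<rfloor> = j" "j \<le> k" using grid_floor[OF t] by metis
    have "sk_path (W k \<omega>) t = (\<Sum>m\<le>k. if j = m then X (real m / real k) \<omega> else 0)"
      unfolding W_def path_sum v j(1) by (intro sum.cong) auto
    then show ?thesis using j by simp
  qed
  show "(\<lambda>\<omega>. g (W (Suc k) \<omega>)) \<in> borel_measurable M" for k
    unfolding W_def by (intro borel_measurable_linear_combination[OF g] X) auto
  fix \<omega> assume \<omega>: "\<omega> \<in> space M"
  have "(\<lambda>k. W (Suc k) \<omega>) \<longlonglongrightarrow> skor (\<lambda>t. X t \<omega>)"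
  proof (rule LIMSEQ_I)
    fix \<epsilon> :: real assume \<epsilon>: "0 < \<epsilon>"
    have "uniformly_continuous_on {0..1} (\<lambda>t. X t \<omega>)"
      using cont[OF \<omega>] by (intro compact_uniformly_continuous) auto
    then obtain \<delta> where \<delta>: "\<delta> > 0" "\<And>s t. s \<in> {0..1} \<Longrightarrow> t \<in> {0..1} \<Longrightarrow> \<bar>s - t\<bar> < \<delta> \<Longrightarrow> \<bar>X s \<omega> - X t \<omega>\<bar> < \<epsilon> / 2"
      using \<epsilon> unfolding uniformly_continuous_on_def dist_real_def by (metis half_gt_zero)
    obtain k0 where k0: "inverse (real (Suc k0)) < \<delta>" using reals_Archimedean[OF \<delta>(1)] by blast
    have "norm (W (Suc k) \<omega> - skor (\<lambda>t. X t \<omega>)) < \<epsilon>" if k: "k0 \<le> k" for k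
    proof -
      have "norm (W (Suc k) \<omega> - skor (\<lambda>t. X t \<omega>)) \<le> \<epsilon> / 2"
      proof (rule norm_path_leI)
        fix t :: real assume t: "t \<in> {0..1}"
        obtain m where m: "nat \<lfloor>real (Suc k) * t\<rfloor> = m" "real m \<le> real (Suc k) * t"
            "real (Suc k) * t < real m + 1" "m \<le> Suc k"
          using grid_floor[OF t, of "Suc k"] by metis
        have le: "real m / real (Suc k) \<le> t" "t < (real m + 1) / real (Suc k)"
          using m(2,3) by (simp_all add: pos_divide_le_eq pos_less_divide_eq mult.commute del: of_nat_Suc)
        then have "\<bar>real m / real (Suc k) - t\<bar> < 1 / real (Suc k)"
          by (simp add: add_divide_distrib del: of_nat_Suc)
        also have "\<dots> \<le> 1 / real (Suc k0)" using k by (intro divide_left_mono) auto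
        also have "\<dots> < \<delta>" using k0 by (simp add: inverse_eq_divide)
        finally have "\<bar>X (real m / real (Suc k)) \<omega> - X t \<omega>\<bar> < \<epsilon> / 2"
          using t m(4) by (intro \<delta>(2)) auto
        then show "\<bar>sk_path (W (Suc k) \<omega> - skor (\<lambda>t. X t \<omega>)) t\<bar> \<le> \<epsilon> / 2"
          using t by (simp add: minus_skorokhod.rep_eq path_W m(1) path_skor cadlag_continuous[OF cont[OF \<omega>]]
              del: of_nat_Suc)
      qed
      then show ?thesis using \<epsilon> by simp
    qed
    then show "\<exists>k0. \<forall>k\<ge>k0. norm (W (Suc k) \<omega> - skor (\<lambda>t. X t \<omega>)) < \<epsilon>" by blast
  qed
  then show "(\<lambda>k. g (W (Suc k) \<omega>)) \<longlonglongrightarrow> g (skor (\<lambda>t. X t \<omega>))"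
    using g by (auto intro: continuous_on_tendsto_compose)
qed

section \<open>Elementary estimates for the comparison\<close>

lemma integral_diff_le_AE:
  fixes f g R :: "'a \<Rightarrow> real"
  assumes "integrable M f" "integrable M g" "integrable M R" "AE \<omega> in M. \<bar>f \<omega> - g \<omega>\<bar> \<le> R \<omega>"
  shows "\<bar>(\<integral>\<omega>. f \<omega> \<partial>M) - (\<integral>\<omega>. g \<omega> \<partial>M)\<bar> \<le> (\<integral>\<omega>. R \<omega> \<partial>M)"
proof -
  have "\<bar>(\<integral>\<omega>. f \<omega> \<partial>M) - (\<integral>\<omega>. g \<omega> \<partial>M)\<bar> = \<bar>\<integral>\<omega>. f \<omega> - g \<omega> \<partial>M\<bar>" using assms by simp
  also have "\<dots> \<le> (\<integral>\<omega>. \<bar>f \<omega> - g \<omega>\<bar> \<partial>M)" by (rule integral_abs_bound)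
  also have "\<dots> \<le> (\<integral>\<omega>. R \<omega> \<partial>M)" using assms by (intro integral_mono_AE) auto
  finally show ?thesis .
qed

text \<open>A time shift of at most 3/n moves the left grid point by at most three cells, hence
  three increments.\<close>

lemma grid_increment:
  assumes n: "n > 0" and H: "\<And>k. k < n \<Longrightarrow> \<bar>f (real (Suc k) / real n) - f (real k / real n)\<bar> \<le> (r::real)"
    and "k \<le> l" "l \<le> k + 3" "l \<le> n"
  shows "\<bar>f (real l / real n) - f (real k / real n)\<bar> \<le> 3 * r"
proof -
  have *: "\<bar>f (real (k + d) / real n) - f (real k / real n)\<bar> \<le> real d * r" if "k + d \<le> n" for d
    using that
  proof (induction d)
    case (Suc d)
    then show ?case using H[of "k + d"] by (simp add: algebra_simps)
  qed simp
  have "0 \<le> r" using order_trans[OF abs_ge_zero H[OF n]] .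
  then have "real (l - k) * r \<le> 3 * r" using assms by (intro mult_right_mono) auto
  then show ?thesis using *[of "l - k"] assms by simp
qed

text \<open>The weights in the arithmetic-geometric mean inequalities are chosen so that they balance
  once the expectations of \<open>S\<^sup>2\<close> and \<open>W\<^sup>2\<close> are bounded by \<open>64\<close> and \<open>a\<^sup>2\<close>.\<close>

lemma product_le_squares:
  fixes a S W c b :: real
  assumes "a > 0" "c \<ge> 0" "b \<ge> 0"
  shows "(1 + c * S) * (W + b * S)
    \<le> (W\<^sup>2 / a + a) / 2 + c * (8 * W\<^sup>2 / a + a * S\<^sup>2 / 8) / 2 + b * (S\<^sup>2 / 8 + 8) / 2 + b * c * S\<^sup>2"
proof -
  have "0 \<le> (W - a)\<^sup>2 / a" using assms by simp
  also have "\<dots> = W\<^sup>2 / a + a - 2 * W" using assms by (simp add: power2_diff field_simps power2_eq_square)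
  finally have 1: "W \<le> (W\<^sup>2 / a + a) / 2" by simp
  have "0 \<le> (8 * W - a * S)\<^sup>2 / (8 * a)" using assms by simp
  also have "\<dots> = 8 * W\<^sup>2 / a + a * S\<^sup>2 / 8 - 2 * (W * S)"
    using assms by (simp add: power2_diff field_simps power2_eq_square)
  finally have 2: "W * S \<le> (8 * W\<^sup>2 / a + a * S\<^sup>2 / 8) / 2" by simp
  have "0 \<le> (S - 8)\<^sup>2 / 8" by simp
  also have "\<dots> = S\<^sup>2 / 8 + 8 - 2 * S" by (simp add: power2_diff field_simps)
  finally have 3: "S \<le> (S\<^sup>2 / 8 + 8) / 2" by simp
  have "(1 + c * S) * (W + b * S) = W + c * (W * S) + b * S + b * c * S\<^sup>2"
    by (simp add: algebra_simps power2_eq_square)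
  then show ?thesis
    using 1 mult_left_mono[OF 2 assms(2)] mult_left_mono[OF 3 assms(3)] by linarith
qed

text \<open>With y = nt, the difference y^2 - m(m-1) equals (y-m)(y+m) + m. The floor contributes at
  most 2n and the final term at most n.\<close>

lemma time_change_gap:
  assumes "0 \<le> t" "t \<le> 1" "real m \<le> real n * t" "real n * t < real m + 1" "n > 0"
  shows "real m * (real m - 1) / (real n)\<^sup>2 \<le> t\<^sup>2"
    "t\<^sup>2 \<le> real m * (real m - 1) / (real n)\<^sup>2 + 3 / real n"
proof -
  let ?y = "real n * t"
  have yn: "?y \<le> real n" using assms mult_left_mono[of t 1 "real n"] by simp
  have y2: "t\<^sup>2 = ?y\<^sup>2 / (real n)\<^sup>2" using assms(5) by (simp add: power_mult_distrib)
  have "real m * (real m - 1) \<le> real m * real m" by (intro mult_left_mono) auto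
  also have "\<dots> \<le> ?y * ?y" using assms by (intro mult_mono) auto
  finally show "real m * (real m - 1) / (real n)\<^sup>2 \<le> t\<^sup>2"
    unfolding y2 by (intro divide_right_mono) (auto simp: power2_eq_square)
  have "(?y - real m) * (?y + real m) \<le> 1 * (2 * real n)"
  proof (rule mult_mono)
    show "?y + real m \<le> 2 * real n" using assms(3) yn by linarith
  qed (use assms in auto)
  then have "?y\<^sup>2 \<le> real m * (real m - 1) + 3 * real n"
    using assms(3) yn by (simp add: algebra_simps power2_eq_square)
  then have "t\<^sup>2 \<le> (real m * (real m - 1) + 3 * real n) / (real n)\<^sup>2"
    unfolding y2 by (rule divide_right_mono) simp
  also have "\<dots> = real m * (real m - 1) / (real n)\<^sup>2 + 3 / real n"
    using assms(5) by (simp add: add_divide_distrib power2_eq_square)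
  finally show "t\<^sup>2 \<le> real m * (real m - 1) / (real n)\<^sup>2 + 3 / real n" .
qed

definition amplitude :: "real \<Rightarrow> real" where
  "amplitude p = sqrt (p * (1 - p) / 2)"

text \<open>Since p(1-p) is at most 1/4, the amplitude is at most 1/sqrt 8; 3/8 is a convenient
  rational value above it.\<close>

lemma amplitude_bounds:
  assumes "0 < p" "p < 1"
  shows "0 < amplitude p" "amplitude p \<le> 3 / 8"
proof -
  show "0 < amplitude p" using assms by (simp add: amplitude_def)
  have "p * (1 - p) \<le> 1 / 4"
    using zero_le_power2[of "p - 1/2"] by (simp add: power2_eq_square algebra_simps)
  then show "amplitude p \<le> 3 / 8"
    unfolding amplitude_def by (intro real_le_lsqrt) (auto simp: power2_eq_square)
qed

section \<open>The Gaussian process built from increments of \<open>B\<close>\<close>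

context standard_brownian_motion
begin

text \<open>The increment has variance 2/n^2; the factor in front raises it to p(1-p), the variance
  of a centred edge indicator.\<close>

definition gauss_edge :: "real \<Rightarrow> nat \<Rightarrow> nat \<times> nat \<Rightarrow> 'b \<Rightarrow> real" where
  "gauss_edge p n e \<omega> = real n * amplitude p *
     (B (2 * real (Suc (edge_index e)) / (real n)\<^sup>2) \<omega> - B (2 * real (edge_index e) / (real n)\<^sup>2) \<omega>)"

text \<open>\<open>B 0\<close> is subtracted because it vanishes only almost surely. The
  identification with a sum over edges then holds for every outcome.\<close>

definition walk_proc :: "real \<Rightarrow> nat \<Rightarrow> 'b \<Rightarrow> real \<Rightarrow> real" where
  "walk_proc p n \<omega> t = amplitude p * ((real_of_int \<lfloor>real n * t\<rfloor> - 2) / real n) *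
     (B (real (nat \<lfloor>real n * t\<rfloor>) * (real (nat \<lfloor>real n * t\<rfloor>) - 1) / (real n)\<^sup>2) \<omega> - B 0 \<omega>)"

lemma cadlag_walk_proc: "n > 0 \<Longrightarrow> cadlag (walk_proc p n \<omega>)"
  unfolding walk_proc_def[abs_def]
  by (rule cadlag_floor[where F = "\<lambda>i. amplitude p * ((real_of_int i - 2) / real n) *
     (B (real (nat i) * (real (nat i) - 1) / (real n)\<^sup>2) \<omega> - B 0 \<omega>)"]) simp

text \<open>The edges among the first \<open>m\<close> vertices carry consecutive increments, which
  telescope up to the time 2 (m choose 2)/n^2 = m(m-1)/n^2.\<close>

lemma skor_walk_proc:
  assumes n: "n > 0"
  shows "skor (walk_proc p n \<omega>) = (\<Sum>e\<in>edges n. gauss_edge p n e \<omega> *\<^sub>R edge_vec n e)"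
  unfolding skor_edge_sum[OF n, symmetric]
proof (rule skor_cong)
  fix t :: real assume t: "t \<in> {0..1}"
  have "(\<Sum>e\<in>edges m. gauss_edge p n e \<omega>) = real n * amplitude p *
      (B (2 * real (m choose 2) / (real n)\<^sup>2) \<omega> - B 0 \<omega>)" for m
    unfolding gauss_edge_def sum_distrib_left[symmetric]
    by (subst sum_edges_telescope[where f = "\<lambda>k. B (2 * real k / (real n)\<^sup>2) \<omega>"]) simp
  then show "walk_proc p n \<omega> t = (real_of_int \<lfloor>real n * t\<rfloor> - 2) / (real n)\<^sup>2 *
      (\<Sum>e\<in>edges (nat \<lfloor>real n * t\<rfloor>). gauss_edge p n e \<omega>)"
    using n by (simp add: walk_proc_def real_choose_two power2_eq_square)
qed

text \<open>The standard deviation \<open>?c * s\<close> is sqrt(p(1-p)), at most 1/2; the third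
  absolute moment is therefore at most 2/8.\<close>

lemma gauss_edge_moments:
  assumes n: "n > 0" and p: "0 < p" "p < 1"
  shows "expectation (gauss_edge p n e) = 0"
    "expectation (\<lambda>\<omega>. (gauss_edge p n e \<omega>)\<^sup>2) = p * (1 - p)"
    "integrable Q (\<lambda>\<omega>. \<bar>gauss_edge p n e \<omega>\<bar> ^ 3)"
    "expectation (\<lambda>\<omega>. \<bar>gauss_edge p n e \<omega>\<bar> ^ 3) \<le> 1"
proof -
  let ?X = "\<lambda>\<omega>. B (2 * real (Suc (edge_index e)) / (real n)\<^sup>2) \<omega> - B (2 * real (edge_index e) / (real n)\<^sup>2) \<omega>"
  let ?c = "real n * amplitude p"
  define s where "s = sqrt 2 / real n"
  have s: "s > 0" using n by (simp add: s_def)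
  have "distributed Q lborel ?X (normal_density 0
      (sqrt (2 * real (Suc (edge_index e)) / (real n)\<^sup>2 - 2 * real (edge_index e) / (real n)\<^sup>2)))"
    using n by (intro BM_normal_increments) (auto simp: divide_strict_right_mono)
  moreover have "sqrt (2 * real (Suc (edge_index e)) / (real n)\<^sup>2 - 2 * real (edge_index e) / (real n)\<^sup>2) = s"
    unfolding s_def by (simp add: real_sqrt_divide flip: diff_divide_distrib)
  ultimately have D: "distributed Q lborel ?X (normal_density 0 s)" by simp
  note m = normal_moments[OF D s]
  have c: "0 < ?c" using n amplitude_bounds[OF p] by simp
  have cs: "(?c * s)\<^sup>2 = p * (1 - p)"
    using n p by (simp add: s_def amplitude_def power_mult_distrib power_divide)
  show "expectation (gauss_edge p n e) = 0"
    unfolding gauss_edge_def[abs_def] using m(1) by simp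
  show "expectation (\<lambda>\<omega>. (gauss_edge p n e \<omega>)\<^sup>2) = p * (1 - p)"
    unfolding gauss_edge_def[abs_def] power_mult_distrib[of ?c] using m(2) cs
    by (simp add: power_mult_distrib[of ?c])
  have e: "\<bar>gauss_edge p n e \<omega>\<bar> ^ 3 = ?c ^ 3 * \<bar>?X \<omega>\<bar> ^ 3" for \<omega>
    unfolding gauss_edge_def abs_mult[of ?c] using c by (simp add: power_mult_distrib)
  show "integrable Q (\<lambda>\<omega>. \<bar>gauss_edge p n e \<omega>\<bar> ^ 3)"
    unfolding e using m(3) by simp
  have "(?c * s)\<^sup>2 \<le> (1 / 2)\<^sup>2"
    unfolding cs using zero_le_power2[of "p - 1/2"] by (simp add: power2_eq_square algebra_simps)
  then have cs2: "?c * s \<le> 1 / 2" by (rule power2_le_imp_le) simp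
  have "expectation (\<lambda>\<omega>. \<bar>gauss_edge p n e \<omega>\<bar> ^ 3) = ?c ^ 3 * expectation (\<lambda>\<omega>. \<bar>?X \<omega>\<bar> ^ 3)"
    unfolding e by simp
  also have "\<dots> \<le> ?c ^ 3 * (2 * s ^ 3)"
    using m(4) c by (intro mult_left_mono) auto
  also have "\<dots> = 2 * (?c * s) ^ 3" by (simp add: power_mult_distrib)
  also have "\<dots> \<le> 2 * (1 / 2) ^ 3"
    using cs2 c s by (intro mult_left_mono power_mono) auto
  finally show "expectation (\<lambda>\<omega>. \<bar>gauss_edge p n e \<omega>\<bar> ^ 3) \<le> 1" by (simp add: power3_eq_cube)
qed

lemma indep_vars_gauss_edge: "indep_vars (\<lambda>_. borel) (gauss_edge p n) (edges n)"
proof -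
  let ?t = "\<lambda>k. 2 * real k / (real n)\<^sup>2"
  have "indep_vars (\<lambda>_. borel) (\<lambda>k \<omega>. B (?t (Suc k)) \<omega> - B (?t k) \<omega>) {..<n choose 2}"
    by (rule BM_independent_increments) (auto intro!: divide_right_mono)
  then have "indep_vars (\<lambda>_. borel) (\<lambda>k \<omega>. real n * amplitude p * (B (?t (Suc k)) \<omega> - B (?t k) \<omega>))
      {..<n choose 2}"
    by (rule indep_vars_compose2) measurable
  then have "indep_vars (\<lambda>_. borel) (\<lambda>k \<omega>. real n * amplitude p * (B (?t (Suc k)) \<omega> - B (?t k) \<omega>))
      (edge_index ` edges n)"
    using bij_betw_edge_index[of n] by (simp add: bij_betw_def)
  from indep_vars_reindex[OF this] show ?thesis
    unfolding gauss_edge_def[abs_def] using bij_betw_edge_index[of n] by (simp add: bij_betw_def)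
qed

end

lemma bernoulli_centred_moments:
  assumes P: "prob_space P" and I: "bernoulli_rv P p X" and p: "0 < p" "p < 1"
  shows "(\<integral>\<omega>. X \<omega> - p \<partial>P) = 0" "(\<integral>\<omega>. (X \<omega> - p)\<^sup>2 \<partial>P) = p * (1 - p)"
    "integrable P (\<lambda>\<omega>. \<bar>X \<omega> - p\<bar> ^ 3)" "(\<integral>\<omega>. \<bar>X \<omega> - p\<bar> ^ 3 \<partial>P) \<le> 1"
proof -
  note E = bernoulli_rv_expectation[OF P I p]
  show "(\<integral>\<omega>. X \<omega> - p \<partial>P) = 0"
    using E(2)[of "\<lambda>x. x - p"] by (simp add: algebra_simps)
  show "(\<integral>\<omega>. (X \<omega> - p)\<^sup>2 \<partial>P) = p * (1 - p)"
    using E(2)[of "\<lambda>x. (x - p)\<^sup>2"] by (simp add: algebra_simps power2_eq_square)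
  show "integrable P (\<lambda>\<omega>. \<bar>X \<omega> - p\<bar> ^ 3)"
    using E(1)[of "\<lambda>x. \<bar>x - p\<bar> ^ 3"] by simp
  have "(\<integral>\<omega>. \<bar>X \<omega> - p\<bar> ^ 3 \<partial>P) = p * \<bar>1 - p\<bar> ^ 3 + (1 - p) * \<bar>0 - p\<bar> ^ 3"
    using E(2)[of "\<lambda>x. \<bar>x - p\<bar> ^ 3"] by simp
  also have "\<dots> \<le> p * 1 + (1 - p) * 1"
    using p by (intro add_mono mult_left_mono power_le_one) auto
  finally show "(\<integral>\<omega>. \<bar>X \<omega> - p\<bar> ^ 3 \<partial>P) \<le> 1" by simp
qed

section \<open>Distances between the three processes\<close>

context standard_brownian_motion
begin

text \<open>Each of the n(n-1)/2 edges costs at most K/(2n^3) times the two third moments, both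
  bounded by 1.\<close>

lemma Y_proc_walk_proc_distance:
  fixes P :: "'a measure"
  assumes n: "n \<ge> 2" and p: "0 < p" "p < 1" and P: "prob_space P"
    and indep: "prob_space.indep_vars P (\<lambda>_. borel) I (edges n)"
    and I: "\<And>e. e \<in> edges n \<Longrightarrow> bernoulli_rv P p (I e)"
    and g: "g \<in> M2_class" and K: "K = enn2real (M2_norm g)"
  shows "\<bar>(\<integral>\<omega>. g (skor (Y_proc P n I \<omega>)) \<partial>P) - (\<integral>\<omega>. g (skor (walk_proc p n \<omega>)) \<partial>Q)\<bar> \<le> K / (2 * real n)"
proof -
  interpret P: prob_space P by fact
  have n0: "n > 0" using n by simp
  note K0 = M2_norm_nonneg[OF g K]
  let ?A = "K * (1 / real n) ^ 3 / 2"
  let ?X = "\<lambda>e \<omega>. I e \<omega> - p"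
  have "(1, 2) \<in> edges n" using n by (simp add: edges_def)
  then have ne: "edges n \<noteq> {}" by blast
  have "\<bar>(\<integral>\<omega>. g (\<Sum>e\<in>edges n. ?X e \<omega> *\<^sub>R edge_vec n e) \<partial>P)
      - (\<integral>\<omega>. g (\<Sum>e\<in>edges n. gauss_edge p n e \<omega> *\<^sub>R edge_vec n e) \<partial>Q)\<bar>
      \<le> (\<Sum>e\<in>edges n. ?A * ((\<integral>\<omega>. \<bar>?X e \<omega>\<bar> ^ 3 \<partial>P) + (\<integral>\<omega>. \<bar>gauss_edge p n e \<omega>\<bar> ^ 3 \<partial>Q)))"
  proof (rule lindeberg[OF finite_edges ne M2_continuous[OF g] M2_quadratic_growth[OF g K]])
    fix e w
    obtain a b where ab: "\<And>x. \<bar>g (w + x *\<^sub>R edge_vec n e) - g w - a * x - b * x\<^sup>2\<bar>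
        \<le> K * norm (edge_vec n e) ^ 3 / 2 * \<bar>x\<bar> ^ 3"
      using M2_quadratic_approximation[OF g K, of w "edge_vec n e"] by blast
    have "K * norm (edge_vec n e) ^ 3 / 2 * \<bar>x\<bar> ^ 3 \<le> ?A * \<bar>x\<bar> ^ 3" for x :: real
      using K0 norm_edge_vec[OF n0, of e]
      by (intro mult_right_mono divide_right_mono mult_left_mono power_mono) auto
    then show "\<exists>a b. \<forall>x. \<bar>g (w + x *\<^sub>R edge_vec n e) - g w - a * x - b * x\<^sup>2\<bar> \<le> ?A * \<bar>x\<bar> ^ 3"
      using ab order_trans by blast
  next
    show "P.indep_vars (\<lambda>_. borel) ?X (edges n)"
      by (rule P.indep_vars_compose2[OF indep]) measurable
  qed (use P prob_space_axioms indep_vars_gauss_edge gauss_edge_moments[OF n0 p]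
      bernoulli_centred_moments[OF P I p] in auto)
  also have "\<dots> \<le> (\<Sum>e\<in>edges n. ?A * (1 + 1))"
    using K0 gauss_edge_moments[OF n0 p] bernoulli_centred_moments[OF P I p]
    by (intro sum_mono mult_left_mono add_mono) auto
  also have "\<dots> = real n * (real n - 1) / 2 * (K * (1 / real n) ^ 3)"
    by (simp add: card_edges real_choose_two)
  also have "\<dots> \<le> real n * real n / 2 * (K * (1 / real n) ^ 3)"
    using K0 n by (intro mult_right_mono divide_right_mono mult_left_mono) auto
  also have "\<dots> = K / (2 * real n)"
    using n0 by (simp add: power3_eq_cube)
  finally show ?thesis
    by (simp add: skor_Y_proc[OF n0 P p I] skor_walk_proc[OF n0])
qed

lemma Z_proc_continuous:
  assumes "\<omega> \<in> space Q"
  shows "continuous_on {0..1} (\<lambda>t. Z_proc p B \<omega> t)"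
  unfolding Z_proc_def
  by (intro continuous_intros continuous_on_compose2[OF BM_continuous[OF assms]]) auto

lemma measurable_functional_Z_proc:
  fixes g :: "skorokhod \<Rightarrow> real"
  assumes "continuous_on UNIV g"
  shows "(\<lambda>\<omega>. g (skor (Z_proc p B \<omega>))) \<in> borel_measurable Q"
proof (rule borel_measurable_continuous_functional[where X = "\<lambda>t \<omega>. Z_proc p B \<omega> t", OF assms])
  show "(\<lambda>\<omega>. Z_proc p B \<omega> t) \<in> borel_measurable Q" for t
    unfolding Z_proc_def by (intro borel_measurable_times measurable_BM) auto
qed (rule Z_proc_continuous)

lemma measurable_functional_walk_proc:
  fixes g :: "skorokhod \<Rightarrow> real"
  assumes n: "n > 0" and g: "continuous_on UNIV g"
  shows "(\<lambda>\<omega>. g (skor (walk_proc p n \<omega>))) \<in> borel_measurable Q"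
  unfolding skor_walk_proc[OF n]
  by (rule borel_measurable_linear_combination[OF g]) (use indep_vars_gauss_edge in \<open>auto simp: indep_vars_def\<close>)

text \<open>The grid approximation with N = 1: every time in [0,1) has left grid point 0, where
  \<open>B\<close> vanishes almost surely, and ln 1 = 0 leaves the constant 64.\<close>

lemma sup_bound:
  obtains U where "integrable Q U" "\<And>\<omega>. 0 \<le> U \<omega>" "expectation U \<le> 64"
    "AE \<omega> in Q. \<forall>s\<in>{0..1}. \<bar>B s \<omega>\<bar> \<le> sqrt (U \<omega>)"
proof -
  obtain U where U: "integrable Q U" "\<And>\<omega>. 0 \<le> U \<omega>" "expectation U \<le> (24 * ln (real 1) + 64) / real 1"
    "AE \<omega> in Q. \<forall>s\<in>{0..1}. \<bar>B s \<omega> - B (real (nat \<lfloor>real 1 * s\<rfloor>) / real 1) \<omega>\<bar> \<le> sqrt (U \<omega>)"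
    using grid_approximation[OF zero_less_one] by blast
  have "AE \<omega> in Q. \<forall>s\<in>{0..1}. \<bar>B s \<omega>\<bar> \<le> sqrt (U \<omega>)"
    using U(4) BM_zero AE_space
  proof eventually_elim
    case (elim \<omega>)
    have lt: "\<bar>B s \<omega>\<bar> \<le> sqrt (U \<omega>)" if s: "s \<in> {0..<1}" for s
    proof -
      have "\<lfloor>s\<rfloor> = 0" using s by (intro floor_unique) auto
      then show ?thesis using elim(1,2) s by (force dest: bspec[of _ _ s])
    qed
    \<comment> \<open>The time 1 is its own grid point, so it is reached by continuity.\<close>
    have "\<bar>B s \<omega>\<bar> \<le> sqrt (U \<omega>)" if "s \<in> closure {0..<1}" for s
    proof (rule continuous_le_on_closure[OF _ that lt])
      show "continuous_on (closure {0..<1}) (\<lambda>s. \<bar>B s \<omega>\<bar>)"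
        by (intro continuous_intros continuous_on_subset[OF BM_continuous[OF elim(3)]]) auto
    qed
    then show ?case by simp
  qed
  then show thesis using U by (intro that[of U]) auto
qed

text \<open>With c = (m-2)/n and s = m(m-1)/n^2, the difference c B(s) - t B(t^2) splits into c
  (B(s) - B(t^2)) and (c-t) B(t^2). The first is governed by the modulus of continuity, the second
  by the supremum.\<close>

lemma walk_proc_Z_proc_pathwise:
  assumes n: "n \<ge> 2" and p: "0 < p" "p < 1" and \<omega>: "\<omega> \<in> space Q" and zero: "B 0 \<omega> = 0"
    and S: "\<And>s. s \<in> {0..1} \<Longrightarrow> \<bar>B s \<omega>\<bar> \<le> S"
    and R: "\<And>s. s \<in> {0..1} \<Longrightarrow> \<bar>B s \<omega> - B (real (nat \<lfloor>real n * s\<rfloor>) / real n) \<omega>\<bar> \<le> R"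
    and r: "\<And>k. k < n \<Longrightarrow> \<bar>B (real (Suc k) / real n) \<omega> - B (real k / real n) \<omega>\<bar> \<le> r"
  shows "norm (skor (Z_proc p B \<omega>)) \<le> amplitude p * S"
    and "norm (skor (walk_proc p n \<omega>)) \<le> amplitude p * S"
    and "norm (skor (walk_proc p n \<omega>) - skor (Z_proc p B \<omega>)) \<le> amplitude p * (2 * R + 3 * r + 3 / real n * S)"
proof -
  have n0: "n > 0" using n by simp
  note a = amplitude_bounds(1)[OF p]
  have S0: "0 \<le> S" using S[of 0] by simp
  have pathZ: "sk_path (skor (Z_proc p B \<omega>)) t = amplitude p * t * B (t\<^sup>2) \<omega>" if "t \<in> {0..1}" for t
    using that by (simp add: path_skor[OF cadlag_Z_proc[OF \<omega>]] Z_proc_def amplitude_def)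
  have t2: "t\<^sup>2 \<in> {0..1}" if "t \<in> {0..1}" for t :: real
    using that by (auto intro: power_le_one)
  show "norm (skor (Z_proc p B \<omega>)) \<le> amplitude p * S"
  proof (rule norm_path_leI)
    fix t :: real assume t: "t \<in> {0..1}"
    have "\<bar>t\<bar> * \<bar>B (t\<^sup>2) \<omega>\<bar> \<le> 1 * S"
      using t S[OF t2[OF t]] by (intro mult_mono) auto
    then have "amplitude p * (\<bar>t\<bar> * \<bar>B (t\<^sup>2) \<omega>\<bar>) \<le> amplitude p * S"
      using a by (intro mult_left_mono) auto
    then show "\<bar>sk_path (skor (Z_proc p B \<omega>)) t\<bar> \<le> amplitude p * S"
      unfolding pathZ[OF t] using a by (simp add: abs_mult)
  qed
  have "\<bar>sk_path (skor (walk_proc p n \<omega>)) t\<bar> \<le> amplitude p * S \<and>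
      \<bar>sk_path (skor (walk_proc p n \<omega>) - skor (Z_proc p B \<omega>)) t\<bar>
      \<le> amplitude p * (2 * R + 3 * r + 3 / real n * S)" if t: "t \<in> {0..1}" for t
  proof -
    obtain m where m: "nat \<lfloor>real n * t\<rfloor> = m" "real_of_int \<lfloor>real n * t\<rfloor> = real m"
        "real m \<le> real n * t" "real n * t < real m + 1" "m \<le> n"
      using grid_floor[OF t] by metis
    define s where "s = real m * (real m - 1) / (real n)\<^sup>2"
    define c where "c = (real m - 2) / real n"
    have s: "s \<le> t\<^sup>2" "t\<^sup>2 \<le> s + 3 / real n"
      unfolding s_def using time_change_gap[of t m n] t m n0 by auto
    have s01: "s \<in> {0..1}"
    proof -
      have "0 \<le> real m * (real m - 1)" by (cases m) auto
      then show ?thesis using s(1) t2[OF t] by (auto simp: s_def)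
    qed
    have c: "\<bar>c\<bar> \<le> 1" "\<bar>c - t\<bar> \<le> 3 / real n"
    proof -
      \<comment> \<open>For m = 0 the left side is 2, so this relies on n being at least 2.\<close>
      have "\<bar>real m - 2\<bar> \<le> real n" using m(5) n by auto
      then show "\<bar>c\<bar> \<le> 1" using n0 by (simp add: c_def abs_divide)
      have "c - t = (real m - 2 - real n * t) / real n" using n0 by (simp add: c_def diff_divide_distrib)
      moreover have "\<bar>real m - 2 - real n * t\<bar> \<le> 3" using m(3,4) by linarith
      ultimately show "\<bar>c - t\<bar> \<le> 3 / real n" by (simp add: abs_divide divide_right_mono)
    qed
    have pathA: "sk_path (skor (walk_proc p n \<omega>)) t = amplitude p * (c * B s \<omega>)"
      using t by (simp add: path_skor[OF cadlag_walk_proc[OF n0]] walk_proc_def m(1,2) c_def s_def zero)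
    have "\<bar>c\<bar> * \<bar>B s \<omega>\<bar> \<le> 1 * S"
      using c(1) S[OF s01] by (intro mult_mono) auto
    then have 1: "\<bar>amplitude p * (c * B s \<omega>)\<bar> \<le> amplitude p * S"
      using a by (simp add: abs_mult)
    \<comment> \<open>\<open>B\<close> is moved from s and from t^2 to their left grid points, at
      cost \<open>R\<close> each; the two grid points are at most three cells apart.\<close>
    define k where "k = nat \<lfloor>real n * s\<rfloor>"
    define l where "l = nat \<lfloor>real n * t\<^sup>2\<rfloor>"
    have ns: "real n * s \<le> real n * t\<^sup>2" "real n * t\<^sup>2 \<le> real n * s + 3"
      using mult_left_mono[OF s(1), of "real n"] mult_left_mono[OF s(2), of "real n"] n0
      by (auto simp: distrib_left)
    have l: "l \<le> n" using grid_floor[OF t2[OF t], of n] l_def by metis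
    have "0 \<le> real n * s" using s01 by auto
    then have kl: "k \<le> l" "l \<le> k + 3" unfolding k_def l_def using ns by linarith+
    have "\<bar>B (real l / real n) \<omega> - B (real k / real n) \<omega>\<bar> \<le> 3 * r"
      by (rule grid_increment[where f = "\<lambda>s. B s \<omega>", OF n0 r kl l])
    then have d: "\<bar>B s \<omega> - B (t\<^sup>2) \<omega>\<bar> \<le> 2 * R + 3 * r"
      using R[OF s01] R[OF t2[OF t]] unfolding k_def[symmetric] l_def[symmetric] by linarith
    have "sk_path (skor (walk_proc p n \<omega>) - skor (Z_proc p B \<omega>)) t
        = amplitude p * (c * (B s \<omega> - B (t\<^sup>2) \<omega>) + (c - t) * B (t\<^sup>2) \<omega>)"
      by (simp add: minus_skorokhod.rep_eq pathA pathZ[OF t] algebra_simps)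
    moreover have "\<bar>c * (B s \<omega> - B (t\<^sup>2) \<omega>) + (c - t) * B (t\<^sup>2) \<omega>\<bar>
        \<le> \<bar>c\<bar> * \<bar>B s \<omega> - B (t\<^sup>2) \<omega>\<bar> + \<bar>c - t\<bar> * \<bar>B (t\<^sup>2) \<omega>\<bar>"
      by (simp add: abs_triangle_ineq flip: abs_mult)
    moreover have "\<dots> \<le> 1 * (2 * R + 3 * r) + 3 / real n * S"
      using c d S[OF t2[OF t]] by (intro add_mono mult_mono) auto
    ultimately have "\<bar>sk_path (skor (walk_proc p n \<omega>) - skor (Z_proc p B \<omega>)) t\<bar>
        \<le> amplitude p * (2 * R + 3 * r + 3 / real n * S)"
      using a by (simp add: abs_mult)
    with 1 show ?thesis by (simp add: pathA)
  qed
  then show "norm (skor (walk_proc p n \<omega>)) \<le> amplitude p * S"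
    and "norm (skor (walk_proc p n \<omega>) - skor (Z_proc p B \<omega>)) \<le> amplitude p * (2 * R + 3 * r + 3 / real n * S)"
    by (auto intro!: norm_path_leI)
qed

text \<open>The pathwise bounds are inserted into the difference bound for \<open>g\<close>, and the
  product is replaced by a majorant linear in squares, whose expectations are known. The constants
  are 63 = 3/8 * 4 * 42 and 36 = 3/8 * (24 + 72).\<close>

lemma walk_proc_Z_proc_distance:
  assumes n: "n \<ge> 2" and p: "0 < p" "p < 1"
    and g: "g \<in> M2_class" and K: "K = enn2real (M2_norm g)"
  shows "\<bar>(\<integral>\<omega>. g (skor (walk_proc p n \<omega>)) \<partial>Q) - (\<integral>\<omega>. g (skor (Z_proc p B \<omega>)) \<partial>Q)\<bar>
    \<le> K * (63 * sqrt (ln (real n) / real n) + 36 / real n)"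
proof -
  have n0: "n > 0" using n by simp
  note K0 = M2_norm_nonneg[OF g K]
  note cont = M2_continuous[OF g]
  define \<kappa> where "\<kappa> = amplitude p"
  have \<kappa>: "0 < \<kappa>" "\<kappa> \<le> 3 / 8" using amplitude_bounds[OF p] by (simp_all add: \<kappa>_def)
  obtain U where U: "integrable Q U" "\<And>\<omega>. 0 \<le> U \<omega>" "expectation U \<le> 64"
    "AE \<omega> in Q. \<forall>s\<in>{0..1}. \<bar>B s \<omega>\<bar> \<le> sqrt (U \<omega>)"
    using sup_bound by blast
  obtain V where V: "integrable Q V" "\<And>\<omega>. 0 \<le> V \<omega>" "expectation V \<le> (24 * ln (real n) + 64) / real n"
    "AE \<omega> in Q. \<forall>s\<in>{0..1}. \<bar>B s \<omega> - B (real (nat \<lfloor>real n * s\<rfloor>) / real n) \<omega>\<bar> \<le> sqrt (V \<omega>)"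
    using grid_approximation[OF n0] by blast
  let ?H = "grid_max_bound n"
  have H: "integrable Q ?H" "expectation ?H \<le> (4 * ln (real n) + 2) / real n" "0 \<le> ?H \<omega>" for \<omega>
    using grid_max_bound_expectation[OF n0] grid_max_bound_nonneg[OF n0] by auto
  define L where "L = ln (real n)"
  have "ln 2 \<le> L" using n by (simp add: L_def)
  then have L: "2 / 3 \<le> L" using ln2_ge_two_thirds by linarith
  \<comment> \<open>Chosen so that \<open>a\<close> squared dominates the expectation of
    \<open>W\<close>: that expectation is at most (364 L + 858)/n, and L at least 2/3 turns this
    into 1651 L / n, below 42^2 L / n.\<close>
  define a where "a = 42 * sqrt (L / real n)"
  have a: "a > 0" "a\<^sup>2 = 1764 * L / real n" using L n0 by (simp_all add: a_def power_mult_distrib)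
  \<comment> \<open>13 = 2^2 + 3^2 comes from Cauchy-Schwarz applied to twice the approximation
    error plus three times the grid increment.\<close>
  define W where "W \<omega> = 13 * (V \<omega> + ?H \<omega>)" for \<omega>
  have W: "integrable Q W" "0 \<le> W \<omega>" for \<omega>
    unfolding W_def using V(1,2) H(1,3) by auto
  have EW: "expectation W \<le> a\<^sup>2"
  proof -
    have "expectation W = 13 * (expectation V + expectation ?H)"
      unfolding W_def using V(1) H(1) by simp
    also have "\<dots> \<le> 13 * ((24 * L + 64) / real n + (4 * L + 2) / real n)"
      using V(3) H(2) unfolding L_def by (intro mult_left_mono add_mono) auto
    also have "\<dots> = (364 * L + 858) / real n"
      by (simp add: algebra_simps flip: add_divide_distrib)
    also have "\<dots> \<le> 1764 * L / real n"
      using L by (intro divide_right_mono) auto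
    finally show ?thesis by (simp add: a)
  qed
  define R where "R \<omega> = K * \<kappa> * ((W \<omega> / a + a) / 2 + \<kappa> * (8 * W \<omega> / a + a * U \<omega> / 8) / 2
      + 3 / real n * (U \<omega> / 8 + 8) / 2 + 3 / real n * \<kappa> * U \<omega>)" for \<omega>
  have R: "integrable Q R" unfolding R_def using W(1) U(1) by auto
  have bounds: "AE \<omega> in Q. \<bar>g (skor (walk_proc p n \<omega>)) - g (skor (Z_proc p B \<omega>))\<bar> \<le> R \<omega> \<and>
      norm (skor (Z_proc p B \<omega>)) \<le> \<kappa> * sqrt (U \<omega>) \<and> norm (skor (walk_proc p n \<omega>)) \<le> \<kappa> * sqrt (U \<omega>)"
    using U(4) V(4) BM_zero AE_space
  proof eventually_elim
    case (elim \<omega>)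
    let ?A = "skor (walk_proc p n \<omega>)" and ?Z = "skor (Z_proc p B \<omega>)"
    let ?S = "sqrt (U \<omega>)" and ?w = "2 * sqrt (V \<omega>) + 3 * sqrt (?H \<omega>)"
    have r: "\<bar>B (real (Suc k) / real n) \<omega> - B (real k / real n) \<omega>\<bar> \<le> sqrt (?H \<omega>)" if "k < n" for k
      using increment_le_grid_max_bound[OF that, of \<omega>] by (intro real_le_rsqrt) simp
    have N: "norm ?Z \<le> \<kappa> * ?S" "norm ?A \<le> \<kappa> * ?S" "norm (?A - ?Z) \<le> \<kappa> * (?w + 3 / real n * ?S)"
      unfolding \<kappa>_def using elim
      by (intro walk_proc_Z_proc_pathwise[where R = "sqrt (V \<omega>)" and r = "sqrt (?H \<omega>)", OF n p elim(4) elim(3) _ _ r];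
          simp)+
    have "\<bar>g ?A - g ?Z\<bar> \<le> K * (1 + (norm ?A + norm ?Z) / 2) * norm (?A - ?Z)"
      by (rule M2_difference_bound[OF g K])
    also have "\<dots> \<le> K * (1 + \<kappa> * ?S) * (\<kappa> * (?w + 3 / real n * ?S))"
      using N K0 U(2)[of \<omega>] \<kappa> by (intro mult_mono) auto
    also have "\<dots> = K * \<kappa> * ((1 + \<kappa> * ?S) * (?w + 3 / real n * ?S))" by simp
    also have "\<dots> \<le> K * \<kappa> * ((?w\<^sup>2 / a + a) / 2 + \<kappa> * (8 * ?w\<^sup>2 / a + a * ?S\<^sup>2 / 8) / 2
      + 3 / real n * (?S\<^sup>2 / 8 + 8) / 2 + 3 / real n * \<kappa> * ?S\<^sup>2)"
      using K0 \<kappa> a(1) by (intro mult_left_mono product_le_squares) auto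
    also have "\<dots> \<le> R \<omega>"
    proof -
      have "?w\<^sup>2 \<le> (2\<^sup>2 + 3\<^sup>2) * ((sqrt (V \<omega>))\<^sup>2 + (sqrt (?H \<omega>))\<^sup>2)"
        using zero_le_power2[of "3 * sqrt (V \<omega>) - 2 * sqrt (?H \<omega>)"]
        by (simp add: power2_sum power2_diff power_mult_distrib)
      then have "?w\<^sup>2 \<le> W \<omega>" using V(2) H(3) by (simp add: W_def)
      then have w: "?w\<^sup>2 / a \<le> W \<omega> / a" "8 * ?w\<^sup>2 / a \<le> 8 * W \<omega> / a"
        using a(1) by (auto intro!: divide_right_mono)
      have "(?w\<^sup>2 / a + a) / 2 \<le> (W \<omega> / a + a) / 2"
        by (intro divide_right_mono add_right_mono w(1)) simp
      moreover have "\<kappa> * (8 * ?w\<^sup>2 / a + a * ?S\<^sup>2 / 8) / 2 \<le> \<kappa> * (8 * W \<omega> / a + a * U \<omega> / 8) / 2"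
        using \<kappa> a(1) U(2)[of \<omega>]
        by (intro divide_right_mono mult_left_mono add_mono[OF w(2)]) auto
      ultimately show ?thesis
        unfolding R_def using K0 \<kappa> U(2)[of \<omega>] by (intro mult_left_mono add_mono) auto
    qed
    finally show ?case using N by blast
  qed
  have int_bound: "integrable Q (\<lambda>\<omega>. (\<bar>g 0\<bar> + K) * (1 + \<kappa>\<^sup>2 * U \<omega>))" using U(1) by auto
  have growth: "norm (g w) \<le> norm ((\<bar>g 0\<bar> + K) * (1 + \<kappa>\<^sup>2 * U \<omega>))" if "norm w \<le> \<kappa> * sqrt (U \<omega>)" for w \<omega>
  proof -
    have "(norm w)\<^sup>2 \<le> (\<kappa> * sqrt (U \<omega>))\<^sup>2" using that by (intro power_mono) auto
    then have "(norm w)\<^sup>2 \<le> \<kappa>\<^sup>2 * U \<omega>" using U(2) by (simp add: power_mult_distrib)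
    then have "(\<bar>g 0\<bar> + K) * (1 + (norm w)\<^sup>2) \<le> (\<bar>g 0\<bar> + K) * (1 + \<kappa>\<^sup>2 * U \<omega>)"
      using K0 by (intro mult_left_mono) auto
    then show ?thesis using M2_quadratic_growth[OF g K, of w] by simp
  qed
  have iA: "integrable Q (\<lambda>\<omega>. g (skor (walk_proc p n \<omega>)))"
  proof (rule Bochner_Integration.integrable_bound[OF int_bound measurable_functional_walk_proc[OF n0 cont]])
    show "AE \<omega> in Q. norm (g (skor (walk_proc p n \<omega>))) \<le> norm ((\<bar>g 0\<bar> + K) * (1 + \<kappa>\<^sup>2 * U \<omega>))"
      using bounds by eventually_elim (intro growth, blast)
  qed
  have iZ: "integrable Q (\<lambda>\<omega>. g (skor (Z_proc p B \<omega>)))"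
  proof (rule Bochner_Integration.integrable_bound[OF int_bound measurable_functional_Z_proc[OF cont]])
    show "AE \<omega> in Q. norm (g (skor (Z_proc p B \<omega>))) \<le> norm ((\<bar>g 0\<bar> + K) * (1 + \<kappa>\<^sup>2 * U \<omega>))"
      using bounds by eventually_elim (intro growth, blast)
  qed
  have "\<bar>(\<integral>\<omega>. g (skor (walk_proc p n \<omega>)) \<partial>Q) - (\<integral>\<omega>. g (skor (Z_proc p B \<omega>)) \<partial>Q)\<bar> \<le> expectation R"
    using bounds by (intro integral_diff_le_AE iA iZ R) (auto elim: eventually_mono)
  also have "\<dots> = K * \<kappa> * ((expectation W / a + a) / 2 + \<kappa> * (8 * expectation W / a + a * expectation U / 8) / 2
      + 3 / real n * (expectation U / 8 + 8) / 2 + 3 / real n * \<kappa> * expectation U)"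
    unfolding R_def using W(1) U(1) by (simp add: prob_space)
  \<comment> \<open>The weights now balance: the first mean becomes \<open>a\<close>, the second 8a,
    the third 8.\<close>
  also have "\<dots> \<le> K * \<kappa> * ((a\<^sup>2 / a + a) / 2 + \<kappa> * (8 * a\<^sup>2 / a + a * 64 / 8) / 2
      + 3 / real n * (64 / 8 + 8) / 2 + 3 / real n * \<kappa> * 64)"
    using K0 \<kappa> a(1) EW U(3)
    by (intro mult_left_mono add_mono divide_right_mono) auto
  also have "\<dots> = K * (\<kappa> * (a + \<kappa> * (8 * a) + 24 / real n + \<kappa> * (192 / real n)))"
    using a(1) by (simp add: power2_eq_square)
  also have "\<dots> \<le> K * (3/8 * (a + 3/8 * (8 * a) + 24 / real n + 3/8 * (192 / real n)))"
    using K0 \<kappa> a(1) by (intro mult_left_mono mult_mono add_mono mult_right_mono) auto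
  also have "\<dots> = K * (63 * sqrt (ln (real n) / real n) + 36 / real n)"
    by (simp add: a_def L_def)
  finally show ?thesis .
qed

text \<open>This settles n = 1, where the centred process is zero. Replacing the expectation of
  \<open>U\<close> by 64 yields 3 + 4.5 = 7.5, below 9.\<close>

lemma Z_proc_zero_distance:
  assumes p: "0 < p" "p < 1" and g: "g \<in> M2_class" and K: "K = enn2real (M2_norm g)"
  shows "\<bar>g 0 - (\<integral>\<omega>. g (skor (Z_proc p B \<omega>)) \<partial>Q)\<bar> \<le> K * 9"
proof -
  note K0 = M2_norm_nonneg[OF g K]
  define \<kappa> where "\<kappa> = amplitude p"
  have \<kappa>: "0 < \<kappa>" "\<kappa> \<le> 3 / 8" using amplitude_bounds[OF p] by (simp_all add: \<kappa>_def)
  obtain U where U: "integrable Q U" "\<And>\<omega>. 0 \<le> U \<omega>" "expectation U \<le> 64"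
    "AE \<omega> in Q. \<forall>s\<in>{0..1}. \<bar>B s \<omega>\<bar> \<le> sqrt (U \<omega>)"
    using sup_bound by blast
  define R where "R \<omega> = K * (3/8 * (U \<omega> / 8 + 8) / 2 + (3/8)\<^sup>2 * U \<omega> / 2)" for \<omega>
  have R: "integrable Q R" unfolding R_def using U(1) by auto
  have bound: "AE \<omega> in Q. \<bar>g 0 - g (skor (Z_proc p B \<omega>))\<bar> \<le> R \<omega>"
    using U(4) AE_space
  proof eventually_elim
    case (elim \<omega>)
    let ?Z = "skor (Z_proc p B \<omega>)" and ?S = "sqrt (U \<omega>)"
    have "norm ?Z \<le> 3/8 * ?S"
    proof (rule norm_path_leI)
      fix t :: real assume t: "t \<in> {0..1}"
      have "\<bar>t\<bar> * \<bar>B (t\<^sup>2) \<omega>\<bar> \<le> 1 * ?S"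
      proof (rule mult_mono)
        have "t\<^sup>2 \<in> {0..1}" using t by (auto intro: power_le_one)
        then show "\<bar>B (t\<^sup>2) \<omega>\<bar> \<le> ?S" using elim(1) by blast
      qed (use t in auto)
      then have "\<kappa> * (\<bar>t\<bar> * \<bar>B (t\<^sup>2) \<omega>\<bar>) \<le> 3/8 * ?S"
        using \<kappa> U(2)[of \<omega>] by (intro mult_mono) auto
      then show "\<bar>sk_path ?Z t\<bar> \<le> 3/8 * ?S"
        using t \<kappa> by (simp add: path_skor[OF cadlag_Z_proc[OF elim(2)]] Z_proc_def \<kappa>_def[symmetric]
            amplitude_def[symmetric] abs_mult)
    qed
    then have "norm ?Z * (1 + norm ?Z / 2) \<le> 3/8 * ?S * (1 + 3/8 * ?S / 2)"
      using U(2)[of \<omega>] by (intro mult_mono add_mono divide_right_mono) auto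
    also have "\<dots> = 3/8 * ?S + (3/8)\<^sup>2 * U \<omega> / 2"
      using U(2)[of \<omega>] by (simp add: algebra_simps power2_eq_square)
    also have "?S \<le> (U \<omega> / 8 + 8) / 2"
      using zero_le_power2[of "?S - 8"] U(2)[of \<omega>] by (simp add: power2_diff)
    finally have "K * (norm ?Z * (1 + norm ?Z / 2)) \<le> R \<omega>"
      unfolding R_def using K0 by (intro mult_left_mono) auto
    then show ?case
      using M2_difference_bound[OF g K, of 0 ?Z] by (simp add: ac_simps)
  qed
  have i0: "integrable Q (\<lambda>_. g 0)" by simp
  have iZ: "integrable Q (\<lambda>\<omega>. g (skor (Z_proc p B \<omega>)))"
  proof (rule Bochner_Integration.integrable_bound)
    show "integrable Q (\<lambda>\<omega>. \<bar>g 0\<bar> + R \<omega>)" using R by simp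
    show "AE \<omega> in Q. norm (g (skor (Z_proc p B \<omega>))) \<le> norm (\<bar>g 0\<bar> + R \<omega>)"
      using bound by eventually_elim auto
  qed (rule measurable_functional_Z_proc[OF M2_continuous[OF g]])
  have "\<bar>g 0 - (\<integral>\<omega>. g (skor (Z_proc p B \<omega>)) \<partial>Q)\<bar> \<le> expectation R"
    using integral_diff_le_AE[OF i0 iZ R bound] by (simp add: prob_space)
  also have "\<dots> = K * (3/8 * (expectation U / 8 + 8) / 2 + (3/8)\<^sup>2 * expectation U / 2)"
    unfolding R_def using U(1) by (simp add: prob_space)
  also have "\<dots> \<le> K * 9"
  proof (rule mult_left_mono[OF _ K0])
    show "3/8 * (expectation U / 8 + 8) / 2 + (3/8)\<^sup>2 * expectation U / 2 \<le> 9"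
      using U(3) by (simp add: power2_eq_square field_simps)
  qed
  finally show ?thesis .
qed

end

theorem theorem6p4:
  fixes P :: "'a measure" and Q :: "'b measure"
    and n :: nat and p :: real
    and I :: "nat \<times> nat \<Rightarrow> 'a \<Rightarrow> real"
    and B :: "real \<Rightarrow> 'b \<Rightarrow> real"
    and g :: "skorokhod \<Rightarrow> real"
  assumes "n > 0" and "0 < p" and "p < 1"
    and "prob_space P"
    and "prob_space.indep_vars P (\<lambda>_. borel) I (edges n)"
    and "\<And>e. e \<in> edges n \<Longrightarrow> bernoulli_rv P p (I e)"
    and "standard_brownian_motion Q B"
    and "g \<in> M2_class"
  shows "\<bar>(\<integral>\<omega>. g (skor (Y_proc P n I \<omega>)) \<partial>P) - (\<integral>\<omega>. g (skor (Z_proc p B \<omega>)) \<partial>Q)\<bar>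
           \<le> enn2real (M2_norm g) * (9 / real n + 90 / sqrt (real n) * sqrt (ln (real n)))"
proof -
  interpret P: prob_space P by fact
  interpret BM: standard_brownian_motion Q B by fact
  define K where "K = enn2real (M2_norm g)"
  note gK = \<open>g \<in> M2_class\<close> K_def
  note K0 = M2_norm_nonneg[OF gK]
  show ?thesis
  proof (cases "n = 1")
    case True
    have "edges 1 = {}" by (auto simp: edges_def)
    then have "skor (Y_proc P n I \<omega>) = 0" for \<omega>
      using skor_Y_proc[OF assms(1,4,2,3,6)] True by simp
    then show ?thesis
      using BM.Z_proc_zero_distance[OF assms(2,3) gK] True by (simp add: P.prob_space K_def)
  next
    case False
    then have n: "n \<ge> 2" using assms(1) by simp
    define x where "x = sqrt (ln (real n) / real n)"
    have x: "90 / sqrt (real n) * sqrt (ln (real n)) = 90 * x" by (simp add: x_def real_sqrt_divide)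
    have "\<bar>(\<integral>\<omega>. g (skor (Y_proc P n I \<omega>)) \<partial>P) - (\<integral>\<omega>. g (skor (Z_proc p B \<omega>)) \<partial>Q)\<bar>
        \<le> K / (2 * real n) + K * (63 * x + 36 / real n)"
      using BM.Y_proc_walk_proc_distance[OF n assms(2-6) gK] BM.walk_proc_Z_proc_distance[OF n assms(2,3) gK]
      unfolding x_def by linarith
    also have "\<dots> = K * (9 / real n + (63 * x + 27.5 * (1 / real n)))"
      by (simp add: field_simps)
    also have "\<dots> \<le> K * (9 / real n + 90 * x)"
    proof -
      have "ln 2 \<le> ln (real n)" using n by simp
      then have "2 / 3 \<le> ln (real n)" using ln2_ge_two_thirds by linarith
      \<comment> \<open>The product n ln n is at least 4/3, above 100/81 = 1/0.9^2, which gives 1/n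
        at most 0.9 x. Then 27.5 * 0.9 = 24.75 fits into the spare 27.\<close>
      then have L: "2 * (2 / 3) \<le> real n * ln (real n)" using n by (intro mult_mono) auto
      have "(1 / (0.9 * real n))\<^sup>2 = 100 / 81 / (real n)\<^sup>2" by (simp add: power2_eq_square)
      also have "\<dots> \<le> 4 / 3 / (real n)\<^sup>2" by (intro divide_right_mono) auto
      also have "4 / 3 / (real n)\<^sup>2 \<le> real n * ln (real n) / (real n)\<^sup>2"
        using L by (intro divide_right_mono) auto
      also have "\<dots> = ln (real n) / real n" using n by (simp add: power2_eq_square)
      finally have "1 / (0.9 * real n) \<le> x" unfolding x_def by (rule real_le_rsqrt)
      then have "1 / real n \<le> 0.9 * x" using n by (simp add: field_simps)
      moreover have "0 \<le> x" unfolding x_def using n by simp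
      ultimately have "63 * x + 27.5 * (1 / real n) \<le> 90 * x" by linarith
      then show ?thesis using K0 by (intro mult_left_mono add_mono) auto
    qed
    finally show ?thesis by (simp only: K_def x)
  qed
qed

end
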